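(* For every braid $X\in\mathbf{B}_3$, the number of orbits of the Hurwitz action on the set of quasipositive factorizations of $X$ is finite.
   Context: $\mathbf{B}_3=\langle\sigma_1,\sigma_2\mid\sigma_1\sigma_2\sigma_1=\sigma_2\sigma_1\sigma_2\rangle$ is the group of braids with three strings. A quasipositive factorization of $X\in\mathbf{B}_3$ is a tuple $(X_1,\dots,X_k)\in\mathbf{B}_3^k$ such that $X_1\cdots X_k=X$ and each $X_i$ is conjugate in $\mathbf{B}_3$ to $\sigma_1$. (The length $k$ is determined by $X$: it is the image of $X$ under the homomorphism $\mathbf{B}_3\to\mathbb{Z}$ sending $\sigma_1,\sigma_2$ to $1$.) For a group $G$ and $1\le i<k$, define $\Sigma_i:G^k\to G^k$ by $\Sigma_i(X_1,\dots,X_k)=(Y_1,\dots,Y_k)$ where $(Y_i,Y_{i+1})=(X_iX_{i+1}X_i^{-1},X_i)$ and $Y_j=X_j$ for $j\notin\{i,i+1\}$. These maps are invertible, and $\sigma_i\mapsto\Sigma_i$ defines an action of the braid group $\mathbf{B}_k$ on $G^k$, called the Hurwitz action. With $G=\mathbf{B}_3$ it preserves the set of quasipositive factorizations of a given braid. *)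

theory Defs
  imports "HOL-Algebra.Group_Action"
begin

section \<open>Groups given by generators and relations\<close>

text \<open>The letter \<^term>\<open>(x, True)\<close> stands for the generator \<open>x\<close>, and \<^term>\<open>(x, False)\<close> for its
  inverse.\<close>

type_synonym 'a word = "('a \<times> bool) list"

definition words :: "'a set \<Rightarrow> 'a word set" where
  "words S = lists (S \<times> UNIV)"

inductive_set word_rel :: "'a set \<Rightarrow> ('a word \<times> 'a word) set \<Rightarrow> ('a word \<times> 'a word) set"
  for S :: "'a set" and R :: "('a word \<times> 'a word) set" where
  refl: "u \<in> words S \<Longrightarrow> (u, u) \<in> word_rel S R"
| sym: "(u, v) \<in> word_rel S R \<Longrightarrow> (v, u) \<in> word_rel S R"
| trans: "(u, v) \<in> word_rel S R \<Longrightarrow> (v, w) \<in> word_rel S R \<Longrightarrow> (u, w) \<in> word_rel S R"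
| append: "(u, u') \<in> word_rel S R \<Longrightarrow> (v, v') \<in> word_rel S R \<Longrightarrow> (u @ v, u' @ v') \<in> word_rel S R"
| cancel: "x \<in> S \<Longrightarrow> ([(x, b), (x, \<not> b)], []) \<in> word_rel S R"
| relation: "(u, v) \<in> R \<Longrightarrow> u \<in> words S \<Longrightarrow> v \<in> words S \<Longrightarrow> (u, v) \<in> word_rel S R"

definition presented_group :: "'a set \<Rightarrow> ('a word \<times> 'a word) set \<Rightarrow> 'a word set monoid" where
  "presented_group S R =
     \<lparr>carrier = words S // word_rel S R,
      mult = (\<lambda>A B. \<Union>u\<in>A. \<Union>v\<in>B. word_rel S R `` {u @ v}),
      one = word_rel S R `` {[]}\<rparr>"

lemma words_simps [simp]:
  "([] :: 'a word) \<in> words S"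
  "a # u \<in> words S \<longleftrightarrow> fst a \<in> S \<and> u \<in> words S"
  "u @ v \<in> words S \<longleftrightarrow> u \<in> words S \<and> v \<in> words S"
  by (auto simp: words_def mem_Times_iff)

lemma word_rel_words: "(u, v) \<in> word_rel S R \<Longrightarrow> u \<in> words S \<and> v \<in> words S"
  by (induction rule: word_rel.induct) auto

lemma equiv_word_rel: "equiv (words S) (word_rel S R)"
proof (rule equivI)
  show "word_rel S R \<subseteq> words S \<times> words S"
    using word_rel_words by auto
  show "refl_on (words S) (word_rel S R)"
    by (auto simp: refl_on_def intro: word_rel.refl)
  show "sym (word_rel S R)"
    by (auto simp: sym_on_def intro: word_rel.sym)
  show "trans (word_rel S R)"
    by (auto simp: trans_on_def intro: word_rel.trans)
qed

lemma presented_mult: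
  assumes "u \<in> words S" "v \<in> words S"
  shows "word_rel S R `` {u} \<otimes>\<^bsub>presented_group S R\<^esub> word_rel S R `` {v} = word_rel S R `` {u @ v}"
proof -
  have "congruent2 (word_rel S R) (word_rel S R) (\<lambda>u v. word_rel S R `` {u @ v})"
    by (auto intro!: congruent2I' equiv_class_eq[OF equiv_word_rel] word_rel.append)
  from UN_equiv_class2[OF equiv_word_rel equiv_word_rel this assms]
  show ?thesis by (simp add: presented_group_def)
qed

lemma presented_carrierE:
  assumes "A \<in> carrier (presented_group S R)"
  obtains u where "u \<in> words S" "A = word_rel S R `` {u}"
  using assms by (auto simp: presented_group_def elim!: quotientE)

lemma presented_carrierI:
  "u \<in> words S \<Longrightarrow> word_rel S R `` {u} \<in> carrier (presented_group S R)"
  by (auto simp: presented_group_def intro: quotientI)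

lemma presented_one: "\<one>\<^bsub>presented_group S R\<^esub> = word_rel S R `` {[]}"
  by (simp add: presented_group_def)

lemma word_rel_left_inverse:
  "u \<in> words S \<Longrightarrow>
     \<exists>v \<in> words S. (v @ u, []) \<in> word_rel S R"
proof (induction u)
  case Nil
  then show ?case by (auto intro!: bexI[of _ "[]"] word_rel.refl)
next
  case (Cons a u)
  obtain x b where a: "a = (x, b)" by (cases a)
  from Cons obtain v where v: "v \<in> words S" "(v @ u, []) \<in> word_rel S R" by auto
  have xS: "x \<in> S" using Cons.prems a by simp
  have "([(x, \<not> b), (x, b)], []) \<in> word_rel S R"
    using word_rel.cancel[OF xS, of "\<not> b"] by simp
  then have "(v @ ([(x, \<not> b), (x, b)] @ u), v @ ([] @ u)) \<in> word_rel S R"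
    using v Cons.prems by (intro word_rel.append word_rel.refl) auto
  with v have "((v @ [(x, \<not> b)]) @ (a # u), []) \<in> word_rel S R"
    by (auto simp: a intro: word_rel.trans)
  with v xS show ?case by (intro bexI[of _ "v @ [(x, \<not> b)]"]) auto
qed

lemma group_presented_group: "group (presented_group S R)"
proof (rule groupI)
  fix A B C
  assume A: "A \<in> carrier (presented_group S R)" and B: "B \<in> carrier (presented_group S R)"
  show "A \<otimes>\<^bsub>presented_group S R\<^esub> B \<in> carrier (presented_group S R)"
    using A B by (auto simp: presented_mult elim!: presented_carrierE intro!: presented_carrierI)
  assume C: "C \<in> carrier (presented_group S R)"
  show "A \<otimes>\<^bsub>presented_group S R\<^esub> B \<otimes>\<^bsub>presented_group S R\<^esub> C =
    A \<otimes>\<^bsub>presented_group S R\<^esub> (B \<otimes>\<^bsub>presented_group S R\<^esub> C)"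
    using A B C by (auto simp: presented_mult elim!: presented_carrierE)
next
  show "\<one>\<^bsub>presented_group S R\<^esub> \<in> carrier (presented_group S R)"
    by (simp add: presented_one presented_carrierI)
next
  fix A assume A: "A \<in> carrier (presented_group S R)"
  then obtain u where u: "u \<in> words S" "A = word_rel S R `` {u}"
    by (rule presented_carrierE)
  show "\<one>\<^bsub>presented_group S R\<^esub> \<otimes>\<^bsub>presented_group S R\<^esub> A = A"
    using u by (simp add: presented_one presented_mult)
  obtain v where v: "v \<in> words S" "(v @ u, []) \<in> word_rel S R"
    using word_rel_left_inverse[OF u(1)] by blast
  then have "word_rel S R `` {v} \<otimes>\<^bsub>presented_group S R\<^esub> A = \<one>\<^bsub>presented_group S R\<^esub>"
    using u by (simp add: presented_one presented_mult equiv_class_eq[OF equiv_word_rel])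
  then show "\<exists>B\<in>carrier (presented_group S R).
      B \<otimes>\<^bsub>presented_group S R\<^esub> A = \<one>\<^bsub>presented_group S R\<^esub>"
    using v presented_carrierI by blast
qed


section \<open>Homomorphisms out of a presented group\<close>

definition word_value :: "('b, 'c) monoid_scheme \<Rightarrow> ('a \<Rightarrow> 'b) \<Rightarrow> 'a word \<Rightarrow> 'b" where
  "word_value H f w =
     foldr (\<lambda>(x, b) h. (if b then f x else inv\<^bsub>H\<^esub> f x) \<otimes>\<^bsub>H\<^esub> h) w \<one>\<^bsub>H\<^esub>"

text \<open>The homomorphism that extends a map \<open>f\<close> of the generators. The choice of a representative is
  irrelevant when \<open>f\<close> respects the relations, see \<open>hom_of_generators_class\<close> below.\<close>

definition hom_of_generators ::
    "('b, 'c) monoid_scheme \<Rightarrow> ('a \<Rightarrow> 'b) \<Rightarrow> 'a word set \<Rightarrow> 'b" where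
  "hom_of_generators H f A = word_value H f (SOME w. w \<in> A)"

context
  fixes H (structure) and S :: "'a set" and R :: "('a word \<times> 'a word) set" and f :: "'a \<Rightarrow> 'b"
  assumes H: "group H"
    and f: "\<And>x. x \<in> S \<Longrightarrow> f x \<in> carrier H"
    and R: "\<And>u v. (u, v) \<in> R \<Longrightarrow> u \<in> words S \<Longrightarrow> v \<in> words S \<Longrightarrow>
              word_value H f u = word_value H f v"
begin

interpretation H: group H by (fact H)

lemma word_value_closed: "u \<in> words S \<Longrightarrow> word_value H f u \<in> carrier H"
  by (induction u) (auto simp: word_value_def f)

lemma word_value_append:
  "u \<in> words S \<Longrightarrow> v \<in> words S \<Longrightarrow>
     word_value H f (u @ v) = word_value H f u \<otimes> word_value H f v"
proof (induction u)
  case Nil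
  then show ?case using word_value_closed[of v] by (simp add: word_value_def)
next
  case (Cons a u)
  then show ?case using word_value_closed[of v] word_value_closed[of u]
    by (auto simp: word_value_def f H.m_assoc split: prod.splits)
qed

lemma word_value_cong: "(u, v) \<in> word_rel S R \<Longrightarrow> word_value H f u = word_value H f v"
proof (induction rule: word_rel.induct)
  case (append u u' v v')
  then show ?case using word_rel_words by (metis word_value_append)
next
  case (cancel x b)
  then show ?case by (auto simp: word_value_def f)
qed (auto intro: R)

lemma hom_of_generators_class:
  assumes "u \<in> words S"
  shows "hom_of_generators H f (word_rel S R `` {u}) = word_value H f u"
proof -
  have "u \<in> word_rel S R `` {u}" using assms by (auto intro: word_rel.refl)
  then have "(SOME w. w \<in> word_rel S R `` {u}) \<in> word_rel S R `` {u}" by (rule someI)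
  then show ?thesis unfolding hom_of_generators_def using word_value_cong by auto
qed

lemma hom_of_generators_hom: "hom_of_generators H f \<in> hom (presented_group S R) H"
  by (rule homI)
    (auto elim!: presented_carrierE
      simp: hom_of_generators_class presented_mult word_value_closed word_value_append)

end


section \<open>Braid groups\<close>

definition braid_relations :: "nat \<Rightarrow> (nat word \<times> nat word) set" where
  "braid_relations n =
     {([(i, True), (j, True), (i, True)], [(j, True), (i, True), (j, True)]) |
        i j. i \<in> {1..<n} \<and> j \<in> {1..<n} \<and> j = i + 1} \<union>
     {([(i, True), (j, True)], [(j, True), (i, True)]) |
        i j. i \<in> {1..<n} \<and> j \<in> {1..<n} \<and> i + 1 < j}"

definition braid_group :: "nat \<Rightarrow> nat word set monoid" where
  "braid_group n = presented_group {1..<n} (braid_relations n)"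

definition braid_gen :: "nat \<Rightarrow> nat \<Rightarrow> nat word set" where
  "braid_gen n i = word_rel {1..<n} (braid_relations n) `` {[(i, True)]}"

lemma group_braid_group: "group (braid_group n)"
  unfolding braid_group_def by (rule group_presented_group)

lemma braid_relations_3:
  "braid_relations 3 =
     {([(1, True), (2, True), (1, True)], [(2, True), (1, True), (2, True)])}"
  by (auto simp: braid_relations_def)


section \<open>The Hurwitz action\<close>

definition tuples :: "('a, 'b) monoid_scheme \<Rightarrow> nat \<Rightarrow> 'a list set" where
  "tuples G k = {Xs. set Xs \<subseteq> carrier G \<and> length Xs = k}"

text \<open>List positions start from 0, so that \<open>X\<^sub>i\<close> is \<^term>\<open>Xs ! (i - 1)\<close>.\<close>

definition hurwitz_move :: "('a, 'b) monoid_scheme \<Rightarrow> nat \<Rightarrow> 'a list \<Rightarrow> 'a list" where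
  "hurwitz_move G i Xs =
     Xs[i - 1 := Xs ! (i - 1) \<otimes>\<^bsub>G\<^esub> Xs ! i \<otimes>\<^bsub>G\<^esub> inv\<^bsub>G\<^esub> (Xs ! (i - 1)), i := Xs ! (i - 1)]"

definition hurwitz_action ::
    "('a, 'b) monoid_scheme \<Rightarrow> nat \<Rightarrow> nat word set \<Rightarrow> 'a list \<Rightarrow> 'a list" where
  "hurwitz_action G k =
     hom_of_generators (BijGroup (tuples G k)) (\<lambda>i. \<lambda>Xs\<in>tuples G k. hurwitz_move G i Xs)"

context
  fixes G (structure) and k :: nat
  assumes G: "group G"
begin

interpretation G: group G by (fact G)

lemma tuples_nth: "Xs \<in> tuples G k \<Longrightarrow> j < k \<Longrightarrow> Xs ! j \<in> carrier G"
  by (auto simp: tuples_def)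

lemma tuples_update: "Xs \<in> tuples G k \<Longrightarrow> x \<in> carrier G \<Longrightarrow> Xs[j := x] \<in> tuples G k"
  by (auto simp: tuples_def dest!: subsetD[OF set_update_subset_insert])

lemma hurwitz_move_tuples:
  "Xs \<in> tuples G k \<Longrightarrow> i \<in> {1..<k} \<Longrightarrow> hurwitz_move G i Xs \<in> tuples G k"
  unfolding hurwitz_move_def by (intro tuples_update G.m_closed G.inv_closed tuples_nth) auto

lemma cancel_inv_left:
  "x \<in> carrier G \<Longrightarrow> y \<in> carrier G \<Longrightarrow> x \<otimes> (inv x \<otimes> y) = y"
  "x \<in> carrier G \<Longrightarrow> y \<in> carrier G \<Longrightarrow> inv x \<otimes> (x \<otimes> y) = y"
  by (simp_all flip: G.m_assoc)

lemma hurwitz_move_Bij: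
  assumes i: "i \<in> {1..<k}"
  shows "(\<lambda>Xs\<in>tuples G k. hurwitz_move G i Xs) \<in> Bij (tuples G k)"
proof -
  define inverse_move where "inverse_move Xs =
    Xs[i - 1 := Xs ! i, i := inv (Xs ! i) \<otimes> Xs ! (i - 1) \<otimes> Xs ! i]" for Xs
  have "bij_betw (hurwitz_move G i) (tuples G k) (tuples G k)"
  proof (rule bij_betw_byWitness[where f' = inverse_move])
    show "\<forall>Xs\<in>tuples G k. inverse_move (hurwitz_move G i Xs) = Xs"
    proof
      fix Xs assume Xs: "Xs \<in> tuples G k"
      then have l: "length Xs = k" by (simp add: tuples_def)
      show "inverse_move (hurwitz_move G i Xs) = Xs"
        using i l tuples_nth[OF Xs, of i] tuples_nth[OF Xs, of "i - 1"]
        by (intro nth_equalityI)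
          (auto simp: inverse_move_def hurwitz_move_def nth_list_update G.m_assoc
            cancel_inv_left)
    qed
    show "\<forall>Xs\<in>tuples G k. hurwitz_move G i (inverse_move Xs) = Xs"
    proof
      fix Xs assume Xs: "Xs \<in> tuples G k"
      then have l: "length Xs = k" by (simp add: tuples_def)
      show "hurwitz_move G i (inverse_move Xs) = Xs"
        using i l tuples_nth[OF Xs, of i] tuples_nth[OF Xs, of "i - 1"]
        by (intro nth_equalityI)
          (auto simp: inverse_move_def hurwitz_move_def nth_list_update G.m_assoc
            cancel_inv_left)
    qed
    show "hurwitz_move G i ` tuples G k \<subseteq> tuples G k"
      using i by (auto intro: hurwitz_move_tuples)
    show "inverse_move ` tuples G k \<subseteq> tuples G k"
      using i
      by (auto simp: inverse_move_def intro!: tuples_update G.m_closed G.inv_closed tuples_nth)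
  qed
  then show ?thesis by (simp add: Bij_def)
qed

lemma hurwitz_move_braid:
  assumes Xs: "Xs \<in> tuples G k" and i: "1 \<le> i" "i + 1 < k"
  shows "hurwitz_move G i (hurwitz_move G (i + 1) (hurwitz_move G i Xs)) =
    hurwitz_move G (i + 1) (hurwitz_move G i (hurwitz_move G (i + 1) Xs))"
proof -
  obtain m where m: "i = Suc m" using i by (cases i) auto
  have l: "length Xs = k" using Xs by (simp add: tuples_def)
  have c: "Xs ! m \<in> carrier G" "Xs ! Suc m \<in> carrier G" "Xs ! Suc (Suc m) \<in> carrier G"
    using i m by (auto intro!: tuples_nth[OF Xs])
  show ?thesis
    using i l c
    by (intro nth_equalityI)
      (auto simp: m hurwitz_move_def nth_list_update G.m_assoc G.inv_mult_group cancel_inv_left)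
qed

lemma hurwitz_move_commute:
  assumes Xs: "Xs \<in> tuples G k" and ij: "1 \<le> i" "i + 1 < j" "j < k"
  shows "hurwitz_move G i (hurwitz_move G j Xs) = hurwitz_move G j (hurwitz_move G i Xs)"
  using assms by (intro nth_equalityI) (auto simp: hurwitz_move_def nth_list_update tuples_def)

abbreviation (input) restricted_move :: "nat \<Rightarrow> 'a list \<Rightarrow> 'a list" where
  "restricted_move \<equiv> \<lambda>i. \<lambda>Xs\<in>tuples G k. hurwitz_move G i Xs"

lemma restricted_move_closed: "i \<in> {1..<k} \<Longrightarrow> restricted_move i \<in> carrier (BijGroup (tuples G k))"
  using hurwitz_move_Bij by (simp add: BijGroup_def)

lemma restricted_move_relations:
  assumes "(u, v) \<in> braid_relations k"
  shows "word_value (BijGroup (tuples G k)) restricted_move u =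
    word_value (BijGroup (tuples G k)) restricted_move v"
proof -
  let ?H = "BijGroup (tuples G k)"
  interpret H: group ?H by (rule group_BijGroup)
  have mult: "g \<otimes>\<^bsub>?H\<^esub> h = compose (tuples G k) g h"
    if "g \<in> carrier ?H" "h \<in> carrier ?H" for g h
    using that by (simp add: BijGroup_def)
  show ?thesis
    using assms unfolding braid_relations_def
  proof (elim UnE CollectE exE conjE)
    fix i j assume *: "(u, v) = ([(i, True), (j, True), (i, True)], [(j, True), (i, True), (j, True)])"
      "i \<in> {1..<k}" "j \<in> {1..<k}" "j = i + 1"
    have "compose (tuples G k) (restricted_move i)
        (compose (tuples G k) (restricted_move j) (restricted_move i)) =
      compose (tuples G k) (restricted_move j)
        (compose (tuples G k) (restricted_move i) (restricted_move j))"
      using * hurwitz_move_braid[of _ i]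
      by (intro ext) (simp add: compose_def restrict_def hurwitz_move_tuples)
    then show ?thesis
      using * restricted_move_closed[of i] restricted_move_closed[of j]
      by (simp add: word_value_def flip: mult)
  next
    fix i j assume *: "(u, v) = ([(i, True), (j, True)], [(j, True), (i, True)])"
      "i \<in> {1..<k}" "j \<in> {1..<k}" "i + 1 < j"
    have "compose (tuples G k) (restricted_move i) (restricted_move j) =
        compose (tuples G k) (restricted_move j) (restricted_move i)"
      using * hurwitz_move_commute[of _ i j]
      by (intro ext) (simp add: compose_def restrict_def hurwitz_move_tuples)
    then show ?thesis
      using * restricted_move_closed[of i] restricted_move_closed[of j]
      by (simp add: word_value_def flip: mult)
  qed
qed

lemma hurwitz_action_group_action:
  "group_action (braid_group k) (tuples G k) (hurwitz_action G k)"
proof -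
  have "hurwitz_action G k \<in> hom (braid_group k) (BijGroup (tuples G k))"
    unfolding hurwitz_action_def braid_group_def
    by (intro hom_of_generators_hom group_BijGroup restricted_move_closed restricted_move_relations)
  then show ?thesis
    by (simp add: group_action_def group_hom_def group_hom_axioms_def group_braid_group
        group_BijGroup)
qed

lemma hurwitz_action_gen:
  assumes "Xs \<in> tuples G k" "i \<in> {1..<k}"
  shows "hurwitz_action G k (braid_gen k i) Xs = hurwitz_move G i Xs"
proof -
  interpret H: group "BijGroup (tuples G k)" by (rule group_BijGroup)
  have "hurwitz_action G k (braid_gen k i) =
      word_value (BijGroup (tuples G k)) restricted_move [(i, True)]"
    unfolding hurwitz_action_def braid_gen_def
    using assms(2)
    by (intro hom_of_generators_class group_BijGroup restricted_move_closed
        restricted_move_relations) auto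
  then show ?thesis
    using assms restricted_move_closed[of i] by (simp add: word_value_def)
qed

end


section \<open>Quasipositive factorizations\<close>

definition quasipositive_factorizations :: "nat word set \<Rightarrow> nat word set list set" where
  "quasipositive_factorizations X =
     {Xs. foldr (\<lambda>Y Z. Y \<otimes>\<^bsub>braid_group 3\<^esub> Z) Xs \<one>\<^bsub>braid_group 3\<^esub> = X \<and>
       (\<forall>Y\<in>set Xs. \<exists>g\<in>carrier (braid_group 3).
          Y = g \<otimes>\<^bsub>braid_group 3\<^esub> braid_gen 3 1 \<otimes>\<^bsub>braid_group 3\<^esub> inv\<^bsub>braid_group 3\<^esub> g)}"

lemma quasipositive_factorizations_tuples:
  assumes "Xs \<in> quasipositive_factorizations X"
  shows "Xs \<in> tuples (braid_group 3) (length Xs)"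
proof -
  interpret B: group "braid_group 3" by (rule group_braid_group)
  have "braid_gen 3 1 \<in> carrier (braid_group 3)"
    unfolding braid_gen_def braid_group_def by (rule presented_carrierI) simp
  then show ?thesis
    using assms by (auto simp: quasipositive_factorizations_def tuples_def)
qed

end

theory Submission
  imports Defs "HOL-Algebra.Elementary_Groups" "HOL-Library.Sublist"
begin

text \<open>
  The braid group on three strings is generated by \<open>x = \<sigma>\<^sub>1\<sigma>\<^sub>2\<sigma>\<^sub>1\<close> and \<open>y = \<sigma>\<^sub>1\<sigma>\<^sub>2\<close>, with \<open>x\<^sup>2 = y\<^sup>3\<close>
  central. Modulo its centre it is the free product of a cyclic group of order 2 and a cyclic group
  of order 3, so it acts on the trivalent tree: \<open>y\<close> rotates the tree about a root and \<open>x\<close> reverses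
  one edge at the root. A conjugate of \<open>\<sigma>\<^sub>1\<close>, called a half twist here, is a translation by one step
  along a horocycle. If \<open>d\<close> is the distance from the root to that horocycle, then the half twist
  moves the root by \<open>2d + 1\<close>: the geodesic goes \<open>d\<close> steps to the horocycle, makes one middle step
  along it, and goes \<open>d\<close> steps away from it.

  Let \<open>len g\<close> be the distance by which \<open>g\<close> moves the root. Take a factorization of \<open>X\<close> into half
  twists whose sum of lengths is minimal in its Hurwitz orbit. Any factor can be moved to the
  first place without changing it, so if some factor has length 1, the orbit contains
  a factorization that starts with this factor. Otherwise all lengths are at least 3. If, at the
  junction of two neighbours \<open>Y\<close> and \<open>Z\<close>, the cancellation reached the middle step of one of
  them, then one of the Hurwitz moves \<open>(Y, Z) \<mapsto> (YZY\<inverse>, Y)\<close> and \<open>(Y, Z) \<mapsto> (Z, Z\<inverse>YZ)\<close> would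
  reduce the sum (\<open>conjugate_shorter_cases\<close>); for neighbours of equal length such a cancellation is
  impossible, because half twists turn all in the same direction (\<open>half_twist_shape\<close>). Hence the
  middle steps survive in the product, and the first half of the first factor is part of
  the geodesic from the root to its image under \<open>X\<close> (\<open>first_half_survives\<close>). In both cases the
  first factor has length at most \<open>max 1 (2 * len X)\<close>.

  Only finitely many half twists satisfy this bound. Indeed, the stabilizer of the root
  consists of the powers of \<open>y\<close>, and only the trivial power has exponent sum 0, so a half twist is
  determined by the image of the root (\<open>act_expo_inj\<close>). The finiteness of the number of orbits
  follows by induction on the number of factors, after splitting off the first factor.
\<close>

section \<open>Hurwitz equivalence of tuples\<close>

text \<open>A relation on tuples of all lengths, rather than one action for each length, lets an induction
  pass between a tuple and the tuple without its first entry.\<close>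

inductive hurwitz_equiv :: "('a, 'b) monoid_scheme \<Rightarrow> 'a list \<Rightarrow> 'a list \<Rightarrow> bool"
  for G (structure) where
  refl: "hurwitz_equiv G Xs Xs"
| sym: "hurwitz_equiv G Xs Ys \<Longrightarrow> hurwitz_equiv G Ys Xs"
| trans: "hurwitz_equiv G Xs Ys \<Longrightarrow> hurwitz_equiv G Ys Zs \<Longrightarrow> hurwitz_equiv G Xs Zs"
| move: "set (us @ Y # Z # vs) \<subseteq> carrier G \<Longrightarrow>
    hurwitz_equiv G (us @ Y # Z # vs) (us @ (Y \<otimes> Z \<otimes> inv Y) # Y # vs)"

lemma hurwitz_equiv_length: "hurwitz_equiv G Xs Ys \<Longrightarrow> length Xs = length Ys"
  by (induction rule: hurwitz_equiv.induct) auto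

lemma (in group_action) orbit_eq:
  assumes "g \<in> carrier G" "x \<in> E"
  shows "orbit G \<phi> (\<phi> g x) = orbit G \<phi> x"
proof -
  have y: "\<phi> g x \<in> E" using element_image assms by blast
  have 1: "\<phi> g x \<in> orbit G \<phi> x" using assms by (auto simp: orbit_def)
  have 2: "x \<in> orbit G \<phi> (\<phi> g x)" using orbit_sym[OF assms(2) y 1] .
  have sub: "orbit G \<phi> u \<subseteq> E" if "u \<in> E" for u
    using element_image that by (auto simp: orbit_def)
  show ?thesis
    using orbit_trans[OF assms(2) y _ 1] orbit_trans[OF y assms(2) _ 2] sub[OF y] sub[OF assms(2)]
    by blast
qed

lemma braid_gen_carrier: "i \<in> {1..<n} \<Longrightarrow> braid_gen n i \<in> carrier (braid_group n)"
  unfolding braid_gen_def braid_group_def by (rule presented_carrierI) simp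

context group
begin

lemma hurwitz_equiv_carrier:
  "hurwitz_equiv G Xs Ys \<Longrightarrow> set Xs \<subseteq> carrier G \<longleftrightarrow> set Ys \<subseteq> carrier G"
  by (induction rule: hurwitz_equiv.induct) auto

lemma hurwitz_equiv_orbit:
  assumes "hurwitz_equiv G Xs Ys" "set Xs \<subseteq> carrier G"
  shows "orbit (braid_group (length Xs)) (hurwitz_action G (length Xs)) Xs =
    orbit (braid_group (length Ys)) (hurwitz_action G (length Ys)) Ys"
  using assms
proof (induction rule: hurwitz_equiv.induct)
  case (move us Y Z vs)
  define k where "k = length (us @ Y # Z # vs)"
  define i where "i = Suc (length us)"
  interpret A: group_action "braid_group k" "tuples G k" "hurwitz_action G k"
    by (rule hurwitz_action_group_action[OF is_group])
  have t: "us @ Y # Z # vs \<in> tuples G k" using move by (simp add: tuples_def k_def)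
  have i: "i \<in> {1..<k}" by (auto simp: i_def k_def)
  have "hurwitz_action G k (braid_gen k i) (us @ Y # Z # vs) = us @ (Y \<otimes> Z \<otimes> inv Y) # Y # vs"
    unfolding hurwitz_action_gen[OF is_group t i]
    by (simp add: hurwitz_move_def i_def nth_append list_update_append)
  with A.orbit_eq[OF braid_gen_carrier[OF i] t]
  show ?case by (simp add: k_def)
next
  case (trans Xs Ys Zs)
  then show ?case using hurwitz_equiv_carrier by metis
next
  case (sym Xs Ys)
  then show ?case using hurwitz_equiv_carrier by metis
qed auto

lemma hurwitz_equiv_Cons:
  assumes "hurwitz_equiv G Xs Ys" "Y \<in> carrier G"
  shows "hurwitz_equiv G (Y # Xs) (Y # Ys)"
  using assms(1)
proof (induction rule: hurwitz_equiv.induct)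
  case (move us U V vs)
  then show ?case using hurwitz_equiv.move[of "Y # us" U V vs G] assms(2) by simp
qed (auto intro: hurwitz_equiv.intros)

abbreviation list_product :: "'a list \<Rightarrow> 'a" where
  "list_product Xs \<equiv> foldr (\<lambda>Y Z. Y \<otimes> Z) Xs \<one>"

lemma list_product_closed: "set Xs \<subseteq> carrier G \<Longrightarrow> list_product Xs \<in> carrier G"
  by (induction Xs) auto

lemma list_product_append:
  "set Xs \<subseteq> carrier G \<Longrightarrow> set Ys \<subseteq> carrier G \<Longrightarrow>
    list_product (Xs @ Ys) = list_product Xs \<otimes> list_product Ys"
proof (induction Xs)
  case Nil
  then show ?case using list_product_closed[of Ys] by simp
next
  case (Cons X Xs)
  then have "list_product Xs \<in> carrier G" "list_product Ys \<in> carrier G"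
    using list_product_closed by auto
  with Cons show ?case by (simp add: m_assoc del: foldr_append)
qed

lemma inv_cancel:
  assumes "x \<in> carrier G" "y \<in> carrier G"
  shows "x \<otimes> (inv x \<otimes> y) = y" "inv x \<otimes> (x \<otimes> y) = y"
  using assms by (simp_all flip: m_assoc)

lemma hurwitz_equiv_product:
  "hurwitz_equiv G Xs Ys \<Longrightarrow> set Xs \<subseteq> carrier G \<Longrightarrow> list_product Xs = list_product Ys"
proof (induction rule: hurwitz_equiv.induct)
  case (move us Y Z vs)
  then show ?case
    by (simp add: list_product_append list_product_closed m_assoc inv_cancel del: foldr_append)
qed (use hurwitz_equiv_carrier in metis)+

text \<open>The inverse of an elementary move.\<close>

lemma hurwitz_equiv_back:
  assumes "set (us @ Y # Z # vs) \<subseteq> carrier G"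
  shows "hurwitz_equiv G (us @ Y # Z # vs) (us @ Z # (inv Z \<otimes> Y \<otimes> Z) # vs)"
proof -
  have "hurwitz_equiv G (us @ Z # (inv Z \<otimes> Y \<otimes> Z) # vs)
      (us @ (Z \<otimes> (inv Z \<otimes> Y \<otimes> Z) \<otimes> inv Z) # Z # vs)"
    using assms by (intro hurwitz_equiv.move) auto
  moreover have "Z \<otimes> (inv Z \<otimes> Y \<otimes> Z) \<otimes> inv Z = Y"
    using assms by (simp add: m_assoc inv_cancel)
  ultimately show ?thesis by (simp add: hurwitz_equiv.sym)
qed

text \<open>An inverse move carries its right entry to the left unchanged; only the entries that are
  passed get conjugated.\<close>

lemma hurwitz_equiv_to_front:
  assumes "set Xs \<subseteq> carrier G" "Y \<in> set Xs"
  shows "\<exists>Ys. hurwitz_equiv G Xs (Y # Ys)"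
  using assms
proof (induction Xs)
  case (Cons X Xs)
  show ?case
  proof (cases "Y = X")
    case True
    then show ?thesis using hurwitz_equiv.refl by blast
  next
    case False
    with Cons obtain Ys where Ys: "hurwitz_equiv G Xs (Y # Ys)" by auto
    have "set (Y # Ys) \<subseteq> carrier G" using hurwitz_equiv_carrier[OF Ys] Cons.prems by simp
    then have "hurwitz_equiv G (X # Y # Ys) (Y # (inv Y \<otimes> X \<otimes> Y) # Ys)"
      using Cons.prems hurwitz_equiv_back[of "[]" X Y Ys] by simp
    moreover have "hurwitz_equiv G (X # Xs) (X # Y # Ys)"
      using hurwitz_equiv_Cons[OF Ys] Cons.prems by simp
    ultimately show ?thesis using hurwitz_equiv.trans by blast
  qed
qed simp

end

section \<open>Length functions\<close>

text \<open>These are the properties of a group action on a tree with a root \<open>o\<close> that the argument uses: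
  \<open>len g\<close> is the distance from \<open>o\<close> to \<open>g o\<close>, and \<open>common g h\<close> is the length of the common part
  of the geodesics from \<open>o\<close> to \<open>g o\<close> and to \<open>h o\<close>. Thus \<open>len\<close> is a Lyndon length function and
  \<open>common\<close> is its Gromov product.\<close>

locale tree_length = group G for G (structure) +
  fixes len :: "'a \<Rightarrow> nat" and common :: "'a \<Rightarrow> 'a \<Rightarrow> nat"
  assumes len_one: "len \<one> = 0"
    and len_quotient: "g \<in> carrier G \<Longrightarrow> h \<in> carrier G \<Longrightarrow>
      len (inv g \<otimes> h) + 2 * common g h = len g + len h"
    and common_ultrametric: "g \<in> carrier G \<Longrightarrow> h \<in> carrier G \<Longrightarrow> k \<in> carrier G \<Longrightarrow>
      min (common g k) (common k h) \<le> common g h"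
    and common_commute: "g \<in> carrier G \<Longrightarrow> h \<in> carrier G \<Longrightarrow> common g h = common h g"
    and common_le: "g \<in> carrier G \<Longrightarrow> h \<in> carrier G \<Longrightarrow> common g h \<le> len g"
begin

lemma common_self: "g \<in> carrier G \<Longrightarrow> common g g = len g"
  using len_quotient[of g g] len_one by simp

lemma len_inv:
  assumes "g \<in> carrier G"
  shows "len (inv g) = len g"
  using len_quotient[of g \<one>] common_le[of \<one> g] common_commute[of g \<one>] len_one assms by simp

text \<open>The geodesic from \<open>o\<close> to \<open>g o\<close> splits at its branching point towards \<open>g h o\<close>. The part after
  that point is the part that cancels in the product of \<open>g\<close> and \<open>h\<close>.\<close>

lemma common_translate:
  assumes "g \<in> carrier G" "h \<in> carrier G"
  shows "common g (g \<otimes> h) + common (inv g) h = len g"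
  using len_quotient[of g "g \<otimes> h"] len_quotient[of "inv g" h] assms
  by (simp add: inv_cancel len_inv)

text \<open>The assumption \<open>mid\<close> says that the geodesics to \<open>X o\<close> and to \<open>X\<inverse> o\<close> agree exactly up to the middle
  edge. If at least half of the shorter geodesic to \<open>g o\<close> runs along that common part, then
  conjugation by \<open>g\<close> removes more of \<open>X\<close> at both ends than it adds.\<close>

lemma conjugate_shorter:
  assumes g: "g \<in> carrier G" and X: "X \<in> carrier G"
    and mid: "2 * common X (inv X) + 1 = len X"
    and less: "len g < len X" and parity: "odd (len g)"
    and overlap: "len g \<le> 2 * common g X"
  shows "len (inv g \<otimes> X \<otimes> g) < len X"
proof -
  have iX: "inv X \<in> carrier G" and Xg: "X \<otimes> g \<in> carrier G" using g X by auto
  \<comment> \<open>Parity turns the assumed weak inequality into the strict one that makes the length drop.\<close>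
  have odd: "len g < 2 * common g X" using overlap parity by presburger
  have "min (common g X) (common X (inv X)) \<le> common g (inv X)"
    using common_ultrametric[OF g iX X] .
  moreover have "len g < 2 * common X (inv X)"
    using mid less parity by presburger
  ultimately have odd': "len g < 2 * common (inv X) g"
    using odd common_commute[OF g iX] by linarith
  have "common X (X \<otimes> g) + common (inv X) g = len X"
    by (rule common_translate[OF X g])
  moreover have "len (X \<otimes> g) + 2 * common (inv X) g = len X + len g"
    using len_quotient[OF iX g] X by (simp add: len_inv)
  moreover have "min (common g X) (common X (X \<otimes> g)) \<le> common g (X \<otimes> g)"
    using common_ultrametric[OF g Xg X] .
  moreover have "len (inv g \<otimes> X \<otimes> g) + 2 * common g (X \<otimes> g) = len g + len (X \<otimes> g)"
    using len_quotient[OF g Xg] g X by (simp add: m_assoc)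
  ultimately show ?thesis using odd odd' less by linarith
qed

text \<open>The part that cancels in the product of \<open>Y\<close> and \<open>Z\<close> is less than one half of each of them.\<close>

definition overlap_short :: "'a \<Rightarrow> 'a \<Rightarrow> bool" where
  "overlap_short Y Z \<longleftrightarrow> 2 * common (inv Y) Z < min (len Y) (len Z)"

text \<open>Less than one half of each factor cancels on either side, so some middle part of every factor
  remains. By the ultrametric inequality, what cancels between a factor and the product of all later
  ones is already determined by the next factor, since more than half of the latter is
  an initial part of that product.\<close>

lemma first_half_survives:
  assumes "set (X # Xs) \<subseteq> carrier G" "successively overlap_short (X # Xs)" "0 < len X"
  shows "len X < 2 * common (list_product (X # Xs)) X"
  using assms
proof (induction Xs arbitrary: X)
  case Nil
  then show ?case using common_self[of X] by simp
next
  case (Cons Y Xs)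
  define P where "P = list_product (Y # Xs)"
  have X: "X \<in> carrier G" and Y: "Y \<in> carrier G" and P: "P \<in> carrier G"
    using Cons.prems list_product_closed[of "Y # Xs"] by (auto simp: P_def)
  have ov: "2 * common (inv X) Y < len X" "2 * common (inv X) Y < len Y"
    using Cons.prems by (auto simp: overlap_short_def)
  have "len Y < 2 * common P Y"
    unfolding P_def using Cons.prems ov by (intro Cons.IH) auto
  moreover have "min (common (inv X) P) (common P Y) \<le> common (inv X) Y"
    using common_ultrametric X Y P by simp
  ultimately have "2 * common (inv X) P < len X" using ov by linarith
  moreover have "common X (X \<otimes> P) + common (inv X) P = len X"
    by (rule common_translate[OF X P])
  ultimately have "len X < 2 * common X (X \<otimes> P)" by linarith
  then show ?case
    using common_commute[of X "X \<otimes> P"] X P by (simp add: P_def)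
qed

end

lemma not_successively_split:
  "\<not> successively P xs \<Longrightarrow> \<exists>us x y vs. xs = us @ x # y # vs \<and> \<not> P x y"
proof (induction P xs rule: successively.induct)
  case (3 P x y xs)
  show ?case
  proof (cases "P x y")
    case True
    then obtain us a b vs where "y # xs = us @ a # b # vs" "\<not> P a b" using 3 by auto
    then have "x # y # xs = (x # us) @ a # b # vs \<and> \<not> P a b" by simp
    then show ?thesis by blast
  next
    case False
    then have "x # y # xs = [] @ x # y # xs \<and> \<not> P x y" by simp
    then show ?thesis by blast
  qed
qed auto

text \<open>By \<open>C_middle\<close> the geodesics to \<open>Y o\<close> and to \<open>Y\<inverse> o\<close> separate exactly at their middle edges.
  By \<open>C_equal_length\<close> the geodesics to \<open>Y\<inverse> o\<close> and to \<open>Z o\<close> do not share their middle edge; this is the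
  case of equal lengths, in which \<open>conjugate_shorter\<close> says nothing. Length 1 has to be excluded
  there: in the braid group the product of \<open>\<sigma>\<^sub>1\<close> and \<open>\<sigma>\<^sub>2\<close> fixes the root, so the two middle edges cancel.\<close>

locale hurwitz_reduction = tree_length +
  fixes C
  assumes C_carrier: "C \<subseteq> carrier G"
    and C_conj: "g \<in> carrier G \<Longrightarrow> Y \<in> C \<Longrightarrow> g \<otimes> Y \<otimes> inv g \<in> C"
    and C_middle: "Y \<in> C \<Longrightarrow> 2 * common Y (inv Y) + 1 = len Y"
    and C_equal_length: "Y \<in> C \<Longrightarrow> Z \<in> C \<Longrightarrow> len Y = len Z \<Longrightarrow> 1 < len Z \<Longrightarrow>
      2 * common (inv Y) Z < len Z"
    and C_finite: "finite {Y \<in> C. len Y \<le> n}"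
begin

lemma C_odd: "Y \<in> C \<Longrightarrow> odd (len Y)"
  using C_middle[of Y] by presburger

lemma conjugate_shorter_cases:
  assumes Y: "Y \<in> C" and Z: "Z \<in> C" and n: "\<not> overlap_short Y Z" and l: "1 < len Y"
  shows "len (Y \<otimes> Z \<otimes> inv Y) < len Z \<or> len (inv Z \<otimes> Y \<otimes> Z) < len Y"
proof -
  have c: "Y \<in> carrier G" "Z \<in> carrier G" using Y Z C_carrier by auto
  consider "len Y < len Z" | "len Z < len Y" | "len Y = len Z" by linarith
  then show ?thesis
  proof cases
    case 1
    have "len (inv (inv Y) \<otimes> Z \<otimes> inv Y) < len Z"
      using c 1 n C_odd[OF Y] C_middle[OF Z]
      by (intro conjugate_shorter) (auto simp: len_inv overlap_short_def)
    then show ?thesis using c by simp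
  next
    case 2
    have "len (inv Z \<otimes> inv Y \<otimes> Z) < len (inv Y)"
      using c 2 n C_odd[OF Z] C_middle[OF Y]
      by (intro conjugate_shorter) (auto simp: len_inv overlap_short_def common_commute)
    moreover have "inv Z \<otimes> inv Y \<otimes> Z = inv (inv Z \<otimes> Y \<otimes> Z)"
      using c by (simp add: inv_mult_group m_assoc)
    ultimately show ?thesis using c by (simp add: len_inv)
  next
    case 3
    then show ?thesis using C_equal_length[OF Y Z] n l by (simp add: overlap_short_def)
  qed
qed

lemma C_conj_inv: "g \<in> carrier G \<Longrightarrow> Y \<in> C \<Longrightarrow> inv g \<otimes> Y \<otimes> g \<in> C"
  using C_conj[of "inv g" Y] by simp

lemma hurwitz_equiv_C:
  assumes "hurwitz_equiv G Xs Ys"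
  shows "set Xs \<subseteq> C \<longleftrightarrow> set Ys \<subseteq> C"
  using assms
proof (induction rule: hurwitz_equiv.induct)
  case (move us Y Z vs)
  then have c: "Y \<in> carrier G" "Z \<in> carrier G" by auto
  have "Z \<in> C" if "Y \<otimes> Z \<otimes> inv Y \<in> C"
    using C_conj_inv[OF c(1) that] c by (simp add: m_assoc inv_cancel)
  then show ?case using C_conj c by auto
qed auto

lemma short_first_factor:
  assumes "set Xs \<subseteq> C" "Xs \<noteq> []"
  shows "\<exists>Y Ys. hurwitz_equiv G Xs (Y # Ys) \<and> len Y \<le> max 1 (2 * len (list_product Xs))"
  using assms
proof (induction "sum_list (map len Xs)" arbitrary: Xs rule: less_induct)
  case less
  have car: "set Xs \<subseteq> carrier G" using less.prems C_carrier by auto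
  show ?case
  proof (cases "\<exists>Y\<in>set Xs. len Y \<le> 1")
    case True
    then obtain Y where "Y \<in> set Xs" "len Y \<le> 1" by blast
    then show ?thesis using hurwitz_equiv_to_front[OF car] by (meson max.coboundedI1)
  next
    case long: False
    show ?thesis
    proof (cases "successively overlap_short Xs")
      case True
      obtain X Xs' where Xs: "Xs = X # Xs'" using less.prems by (cases Xs) auto
      have "0 < len X" using long Xs by auto
      then have "len X < 2 * common (list_product Xs) X"
        using first_half_survives[of X Xs'] True car Xs by simp
      also have "\<dots> \<le> 2 * len (list_product Xs)"
        using common_le[of "list_product Xs" X] list_product_closed[OF car] car Xs by simp
      finally show ?thesis using Xs hurwitz_equiv.refl by (metis less_imp_le max.coboundedI2)
    next
      case False
      then obtain us Y Z vs where Xs: "Xs = us @ Y # Z # vs" and n: "\<not> overlap_short Y Z"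
        using not_successively_split by blast
      have YZ: "Y \<in> C" "Z \<in> C" "1 < len Y" using Xs less.prems long by auto
      obtain Ys where Ys: "hurwitz_equiv G Xs Ys" "sum_list (map len Ys) < sum_list (map len Xs)"
      proof -
        from conjugate_shorter_cases[OF YZ(1,2) n YZ(3)] show ?thesis
        proof
          assume "len (Y \<otimes> Z \<otimes> inv Y) < len Z"
          then show ?thesis using hurwitz_equiv.move[of us Y Z vs G] car Xs
            by (intro that[of "us @ (Y \<otimes> Z \<otimes> inv Y) # Y # vs"]) auto
        next
          assume "len (inv Z \<otimes> Y \<otimes> Z) < len Y"
          then show ?thesis using hurwitz_equiv_back[of us Y Z vs] car Xs
            by (intro that[of "us @ Z # (inv Z \<otimes> Y \<otimes> Z) # vs"]) auto
        qed
      qed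
      have "set Ys \<subseteq> C" "Ys \<noteq> []"
        using hurwitz_equiv_C[OF Ys(1)] hurwitz_equiv_length[OF Ys(1)] less.prems by auto
      from less.hyps[OF Ys(2) this] hurwitz_equiv_product[OF Ys(1) car] Ys(1)
      show ?thesis by (metis hurwitz_equiv.trans)
    qed
  qed
qed

text \<open>Induction on the number of factors: there are finitely many choices for the first factor \<open>Y\<close>,
  and the remaining factors form a factorization of \<open>Y\<inverse>X\<close>.\<close>

theorem finite_representatives:
  assumes "X \<in> carrier G"
  shows "\<exists>R. finite R \<and> (\<forall>Xs. set Xs \<subseteq> C \<and> length Xs = k \<and> list_product Xs = X \<longrightarrow>
    (\<exists>Ys\<in>R. hurwitz_equiv G Xs Ys))"
  using assms
proof (induction k arbitrary: X)
  case 0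
  show ?case by (rule exI[of _ "{[]}"]) (auto intro: hurwitz_equiv.refl)
next
  case (Suc k)
  define F where "F = {Y \<in> C. len Y \<le> max 1 (2 * len X)}"
  have FC: "F \<subseteq> carrier G" using C_carrier by (auto simp: F_def)
  have "\<forall>Y\<in>F. \<exists>R. finite R \<and> (\<forall>Xs. set Xs \<subseteq> C \<and> length Xs = k \<and>
      list_product Xs = inv Y \<otimes> X \<longrightarrow> (\<exists>Ys\<in>R. hurwitz_equiv G Xs Ys))"
    using Suc FC by (intro ballI Suc.IH) auto
  then obtain R where R: "\<And>Y. Y \<in> F \<Longrightarrow> finite (R Y)"
    "\<And>Y Xs. Y \<in> F \<Longrightarrow> set Xs \<subseteq> C \<Longrightarrow> length Xs = k \<Longrightarrow> list_product Xs = inv Y \<otimes> X \<Longrightarrow>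
      \<exists>Ys\<in>R Y. hurwitz_equiv G Xs Ys"
    by metis
  have "\<exists>Zs\<in>(\<Union>Y\<in>F. (#) Y ` R Y). hurwitz_equiv G Xs Zs"
    if Xs: "set Xs \<subseteq> C" "length Xs = Suc k" "list_product Xs = X" for Xs
  proof -
    have car: "set Xs \<subseteq> carrier G" using Xs C_carrier by auto
    have "Xs \<noteq> []" using Xs by auto
    then obtain Y Ys where Y: "hurwitz_equiv G Xs (Y # Ys)" "len Y \<le> max 1 (2 * len X)"
      using short_first_factor[of Xs] Xs by blast
    have C: "Y \<in> C" "set Ys \<subseteq> C" using hurwitz_equiv_C[OF Y(1)] Xs by auto
    have c: "Y \<in> carrier G" "list_product Ys \<in> carrier G"
      using C C_carrier list_product_closed[of Ys] by auto
    have YF: "Y \<in> F" using Y C by (simp add: F_def)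
    have "Y \<otimes> list_product Ys = X" using hurwitz_equiv_product[OF Y(1) car] Xs by simp
    then have "list_product Ys = inv Y \<otimes> X" using c by (auto simp: inv_cancel)
    moreover have "length Ys = k" using hurwitz_equiv_length[OF Y(1)] Xs by simp
    ultimately obtain Zs where "Zs \<in> R Y" "hurwitz_equiv G Ys Zs" using R(2)[OF YF C(2)] by blast
    then show ?thesis
      using hurwitz_equiv.trans[OF Y(1) hurwitz_equiv_Cons] c(1) YF by blast
  qed
  moreover have "finite (\<Union>Y\<in>F. (#) Y ` R Y)"
    using R(1) C_finite by (auto simp: F_def)
  ultimately show ?case by blast
qed

end

section \<open>The trivalent tree\<close>

abbreviation lcp :: "'a list \<Rightarrow> 'a list \<Rightarrow> nat" where
  "lcp u v \<equiv> length (longest_common_prefix u v)"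

lemma lcp_Nil [simp]: "lcp u [] = 0"
  by (cases u) auto

lemma lcp_commute: "lcp u v = lcp v u"
  by (induction u v rule: longest_common_prefix.induct) auto

lemma lcp_le: "lcp u v \<le> length u"
  by (induction u v rule: longest_common_prefix.induct) auto

lemma lcp_ultrametric: "min (lcp u w) (lcp w v) \<le> lcp u v"
proof (induction u v arbitrary: w rule: longest_common_prefix.induct)
  case (1 a u b v)
  then show ?case by (cases w) auto
qed auto

lemma lcp_differ:
  "a \<noteq> b \<Longrightarrow> length u = length v \<Longrightarrow> lcp (u @ a # u') (v @ b # v') \<le> length u"
  by (induction u v rule: list_induct2') auto

lemma lcp_append_differ: "a \<noteq> b \<Longrightarrow> lcp (u @ a # u') (u @ b # v') = length u"
  by (induction u) auto

definition tree_dist :: "'a list \<Rightarrow> 'a list \<Rightarrow> nat" where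
  "tree_dist u v = length u + length v - 2 * lcp u v"

lemma tree_dist_add: "tree_dist u v + 2 * lcp u v = length u + length v"
  using lcp_le[of u v] lcp_le[of v u] by (simp add: tree_dist_def lcp_commute[of v u])

text \<open>A vertex of the trivalent tree is encoded by the sequence of branches on the way from the root
  to it. There are three branches at the root; at every other vertex the branch 0 leads back towards
  the root, so that only the branches 1 and 2 can be taken.\<close>

definition vertices :: "nat list set" where
  "vertices = {v. set v \<subseteq> {..<3} \<and> 0 \<notin> set (tl v)}"

fun rot :: "nat list \<Rightarrow> nat list" where
  "rot [] = []"
| "rot (e # v) = (e + 1) mod 3 # v"

text \<open>The half turn about the midpoint of the edge between the root and its neighbour \<open>[0]\<close>.\<close>

definition flip :: "nat list \<Rightarrow> nat list" where
  "flip v = (if v \<noteq> [] \<and> hd v = 0 then tl v else 0 # v)"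

lemma Nil_vertex [simp]: "[] \<in> vertices"
  by (simp add: vertices_def)

lemma less_3_cases: "(e :: nat) < 3 \<Longrightarrow> e = 0 \<or> e = 1 \<or> e = 2"
  by auto

lemma vertices_Cons:
  "e # v \<in> vertices \<longleftrightarrow> e < 3 \<and> v \<in> vertices \<and> 0 \<notin> set v"
  by (cases v) (auto simp: vertices_def)

lemma rot_vertex: "v \<in> vertices \<Longrightarrow> rot v \<in> vertices"
  by (cases v) (auto simp: vertices_Cons)

lemma flip_vertex: "v \<in> vertices \<Longrightarrow> flip v \<in> vertices"
  by (cases v) (auto simp: vertices_Cons flip_def)

lemma rot_3: "v \<in> vertices \<Longrightarrow> rot (rot (rot v)) = v"
  by (cases v) (auto simp: vertices_Cons dest!: less_3_cases)

lemma flip_flip: "v \<in> vertices \<Longrightarrow> flip (flip v) = v"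
  by (cases v; cases "tl v") (auto simp: vertices_Cons flip_def)

lemma rot_isometry:
  "u \<in> vertices \<Longrightarrow> v \<in> vertices \<Longrightarrow> tree_dist (rot u) (rot v) = tree_dist u v"
  by (cases u; cases v) (auto simp: vertices_Cons tree_dist_def dest!: less_3_cases)

lemma flip_isometry:
  "u \<in> vertices \<Longrightarrow> v \<in> vertices \<Longrightarrow> tree_dist (flip u) (flip v) = tree_dist u v"
  by (cases u; cases v; cases "tl u"; cases "tl v")
    (auto simp: vertices_Cons tree_dist_def flip_def)

lemma finite_short_vertices: "finite {v \<in> vertices. length v \<le> n}"
  by (rule finite_subset[OF _ finite_lists_length_le[of "{..<3}" n]]) (auto simp: vertices_def)

section \<open>The trefoil group\<close>

text \<open>The name comes from the group \<open>\<langle>x, y | x\<^sup>2 = y\<^sup>3\<rangle>\<close> of the trefoil knot, which is the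
  braid group on three strings. Of the presentation only the relation and the fact
  that \<open>x\<close> and \<open>y\<close> generate are kept, together with the two things that distinguish elements: the action on
  the tree and the exponent sum.\<close>

locale trefoil_action = group G for G (structure) +
  fixes x y :: 'a and expo :: "'a \<Rightarrow> int" and \<phi> :: "'a \<Rightarrow> nat list \<Rightarrow> nat list"
  assumes x [simp]: "x \<in> carrier G" and y [simp]: "y \<in> carrier G"
    and square_cube: "x \<otimes> x = y \<otimes> (y \<otimes> y)"
    and generated: "subgroup K G \<Longrightarrow> x \<in> K \<Longrightarrow> y \<in> K \<Longrightarrow> carrier G \<subseteq> K"
    and expo_hom: "expo \<in> hom G integer_group"
    and expo_x: "expo x = 3" and expo_y: "expo y = 2"
    and action: "group_action G vertices \<phi>"
    and act_x: "v \<in> vertices \<Longrightarrow> \<phi> x v = flip v"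
    and act_y: "v \<in> vertices \<Longrightarrow> \<phi> y v = rot v"
begin

interpretation A: group_action G vertices \<phi> by (fact action)

lemma act_closed [simp]: "g \<in> carrier G \<Longrightarrow> v \<in> vertices \<Longrightarrow> \<phi> g v \<in> vertices"
  using A.element_image by blast

lemma act_mult:
  "g \<in> carrier G \<Longrightarrow> h \<in> carrier G \<Longrightarrow> v \<in> vertices \<Longrightarrow> \<phi> (g \<otimes> h) v = \<phi> g (\<phi> h v)"
  using A.composition_rule by blast

lemma act_one: "v \<in> vertices \<Longrightarrow> \<phi> \<one> v = v"
  using A.id_eq_one by (metis restrict_apply')

lemma act_inv:
  assumes "g \<in> carrier G" "v \<in> vertices"
  shows "\<phi> (inv g) (\<phi> g v) = v" "\<phi> g (\<phi> (inv g) v) = v"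
  using act_mult[of "inv g" g v] act_mult[of g "inv g" v] assms by (simp_all add: act_one)

lemma act_inv_x: "v \<in> vertices \<Longrightarrow> \<phi> (inv x) v = flip v"
  using act_inv(1)[of x "flip v"] by (simp add: act_x flip_vertex flip_flip)

lemma act_inv_y: "v \<in> vertices \<Longrightarrow> \<phi> (inv y) v = rot (rot v)"
  using act_inv(1)[of y "rot (rot v)"] by (simp add: act_y rot_vertex rot_3)

lemma act_isometry:
  assumes "g \<in> carrier G" "u \<in> vertices" "v \<in> vertices"
  shows "tree_dist (\<phi> g u) (\<phi> g v) = tree_dist u v"
proof -
  define K where "K = {g \<in> carrier G. \<forall>u\<in>vertices. \<forall>v\<in>vertices.
    tree_dist (\<phi> g u) (\<phi> g v) = tree_dist u v}"
  have "subgroup K G"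
  proof (rule subgroupI)
    show "K \<noteq> {}" using act_one by (auto simp: K_def intro!: exI[of _ \<one>])
    show "inv g \<in> K" if "g \<in> K" for g
    proof -
      have g: "g \<in> carrier G" using that by (simp add: K_def)
      have "tree_dist (\<phi> (inv g) u) (\<phi> (inv g) v) = tree_dist u v"
        if "u \<in> vertices" "v \<in> vertices" for u v
      proof -
        have "tree_dist (\<phi> g (\<phi> (inv g) u)) (\<phi> g (\<phi> (inv g) v)) =
            tree_dist (\<phi> (inv g) u) (\<phi> (inv g) v)"
          using \<open>g \<in> K\<close> that g by (simp add: K_def)
        then show ?thesis using that g by (simp add: act_inv)
      qed
      then show ?thesis using g by (simp add: K_def)
    qed
  qed (auto simp: K_def act_mult)
  then have "carrier G \<subseteq> K"
    by (rule generated)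
      (auto simp: K_def act_x act_y flip_isometry rot_isometry)
  then show ?thesis using assms by (auto simp: K_def)
qed

lemma expo_mult: "g \<in> carrier G \<Longrightarrow> h \<in> carrier G \<Longrightarrow> expo (g \<otimes> h) = expo g + expo h"
  using hom_mult[OF expo_hom] by simp

lemma expo_one: "expo \<one> = 0"
  using expo_mult[of \<one> \<one>] by simp

lemma expo_inv: "g \<in> carrier G \<Longrightarrow> expo (inv g) = - expo g"
  using expo_mult[of g "inv g"] by (simp add: expo_one)

lemma expo_pow_y: "expo (y [^] (j :: int)) = 2 * j"
proof -
  have n: "expo (y [^] (n :: nat)) = 2 * int n" for n
    by (induction n) (simp_all add: expo_one expo_mult expo_y)
  show ?thesis
    by (cases j rule: int_cases2) (simp_all add: int_pow_int int_pow_neg_int expo_inv n)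
qed

text \<open>A standard element that carries the root to a given vertex, see \<open>act_path\<close>. In the group,
  following the generators along the tree agrees with \<open>path\<close> only up to a power
  of \<open>y\<close> on the right, see \<open>act_path_stabilizer\<close>.\<close>

fun path :: "nat list \<Rightarrow> 'a" where
  "path [] = \<one>"
| "path (e # v) = y [^] e \<otimes> (x \<otimes> path v)"

lemma path_closed [simp]: "path v \<in> carrier G"
  by (induction v) auto

lemma path_append: "path (u @ v) = path u \<otimes> path v"
  by (induction u) (auto simp: m_assoc)

lemma act_pow_y: "v \<in> vertices \<Longrightarrow> \<phi> (y [^] (n :: nat)) v = (rot ^^ n) v \<and> (rot ^^ n) v \<in> vertices"
  by (induction n arbitrary: v)
    (simp_all add: act_one act_mult act_y rot_vertex funpow_swap1)

lemma rot_pow: "e < 3 \<Longrightarrow> (rot ^^ e) (0 # v) = e # v"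
  by (auto dest!: less_3_cases simp: numeral_2_eq_2)

lemma act_path: "v @ u \<in> vertices \<Longrightarrow> u \<in> vertices \<Longrightarrow> \<phi> (path v) u = v @ u"
proof (induction v)
  case (Cons e v)
  then have v: "e < 3" "v @ u \<in> vertices" "0 \<notin> set (v @ u)"
    by (auto simp: vertices_Cons)
  then have f: "flip (v @ u) = 0 # v @ u"
    using hd_in_set[of "v @ u"] unfolding flip_def by metis
  have z: "0 # v @ u \<in> vertices" using v by (auto simp: vertices_Cons)
  show ?case
    using v f z act_pow_y[OF z, of e] Cons
    by (simp add: act_mult act_x rot_pow)
qed (simp add: act_one)

lemma square_commute_y: "(x \<otimes> x) \<otimes> y = y \<otimes> (x \<otimes> x)"
  by (simp add: square_cube m_assoc)

lemma square_commute_pow_y: "(x \<otimes> x) \<otimes> y [^] (n :: nat) = y [^] n \<otimes> (x \<otimes> x)"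
proof (induction n)
  case (Suc n)
  have "(x \<otimes> x) \<otimes> y [^] Suc n = ((x \<otimes> x) \<otimes> y [^] n) \<otimes> y" by (simp add: m_assoc)
  also have "\<dots> = y [^] n \<otimes> ((x \<otimes> x) \<otimes> y)" unfolding Suc by (simp add: m_assoc)
  also have "\<dots> = y [^] Suc n \<otimes> (x \<otimes> x)" unfolding square_commute_y by (simp add: m_assoc)
  finally show ?case .
qed simp

lemma square_commute_path: "(x \<otimes> x) \<otimes> path v = path v \<otimes> (x \<otimes> x)"
proof (induction v)
  case (Cons e v)
  have "(x \<otimes> x) \<otimes> path (e # v) = ((x \<otimes> x) \<otimes> y [^] e) \<otimes> (x \<otimes> path v)"
    by (simp add: m_assoc)
  also have "\<dots> = y [^] e \<otimes> (x \<otimes> ((x \<otimes> x) \<otimes> path v))"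
    unfolding square_commute_pow_y by (simp add: m_assoc)
  also have "\<dots> = path (e # v) \<otimes> (x \<otimes> x)" unfolding Cons by (simp add: m_assoc)
  finally show ?case .
qed simp

lemma square_pow: "x \<otimes> x = y [^] (3 :: int)"
proof -
  have "y [^] (3 :: int) = y [^] (3 :: nat)" using int_pow_int[of G y 3] by simp
  then show ?thesis by (simp add: square_cube numeral_3_eq_3 m_assoc)
qed

lemma x_path: "v \<in> vertices \<Longrightarrow> \<exists>j :: int. x \<otimes> path v = path (flip v) \<otimes> y [^] j"
proof (cases "v \<noteq> [] \<and> hd v = 0")
  case True
  then obtain u where v: "v = 0 # u" by (cases v) auto
  have "x \<otimes> path v = path (flip v) \<otimes> y [^] (3 :: int)"
    using square_commute_path[of u] unfolding square_pow[symmetric]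
    by (simp add: v flip_def m_assoc)
  then show ?thesis by blast
next
  case False
  then have "x \<otimes> path v = path (flip v) \<otimes> y [^] (0 :: int)" by (auto simp: flip_def)
  then show ?thesis by blast
qed

lemma y_path: "v \<in> vertices \<Longrightarrow> \<exists>j :: int. y \<otimes> path v = path (rot v) \<otimes> y [^] j"
proof (cases v)
  case Nil
  then have "y \<otimes> path v = path (rot v) \<otimes> y [^] (1 :: int)" by simp
  then show ?thesis by blast
next
  case (Cons e u)
  assume "v \<in> vertices"
  then have "e = 0 \<or> e = 1 \<or> e = 2" using Cons less_3_cases by (simp add: vertices_Cons)
  then consider "e < 2" | "e = 2" by auto
  then show ?thesis
  proof cases
    case 1
    then have "y \<otimes> path v = path (rot v) \<otimes> y [^] (0 :: int)"
      using nat_pow_Suc2[of y e] by (simp add: Cons flip: m_assoc)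
    then show ?thesis by blast
  next
    case 2
    have "y \<otimes> path v = (x \<otimes> x) \<otimes> (x \<otimes> path u)"
      by (simp add: Cons 2 square_cube numeral_2_eq_2 m_assoc)
    also have "\<dots> = x \<otimes> ((x \<otimes> x) \<otimes> path u)" by (simp add: m_assoc)
    also have "\<dots> = path (rot v) \<otimes> y [^] (3 :: int)"
      unfolding square_commute_path unfolding square_pow[symmetric]
      by (simp add: Cons 2 m_assoc)
    finally show ?thesis by blast
  qed
qed

text \<open>For \<open>v = []\<close> this computes the stabilizer of the root. The statement for all \<open>v\<close> is needed
  because it is inherited by products.\<close>

lemma act_path_stabilizer:
  assumes "g \<in> carrier G" "v \<in> vertices"
  shows "\<exists>j :: int. g \<otimes> path v = path (\<phi> g v) \<otimes> y [^] j"
proof -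
  define K where "K = {g \<in> carrier G. \<forall>v\<in>vertices. \<exists>j :: int.
    g \<otimes> path v = path (\<phi> g v) \<otimes> y [^] j}"
  have "subgroup K G"
  proof (rule subgroupI)
    have "\<one> \<otimes> path v = path (\<phi> \<one> v) \<otimes> y [^] (0 :: int)" if "v \<in> vertices" for v
      using that by (simp add: act_one)
    then show "K \<noteq> {}" unfolding K_def by blast
    show "inv g \<in> K" if "g \<in> K" for g
    proof -
      have g: "g \<in> carrier G" using that by (simp add: K_def)
      have "\<exists>j :: int. inv g \<otimes> path v = path (\<phi> (inv g) v) \<otimes> y [^] j" if v: "v \<in> vertices" for v
      proof -
        obtain j :: int where "g \<otimes> path (\<phi> (inv g) v) = path v \<otimes> y [^] j"
          using \<open>g \<in> K\<close> v g act_inv[OF g v] by (auto simp: K_def) (metis act_closed inv_closed)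
        then have "inv g \<otimes> (g \<otimes> path (\<phi> (inv g) v)) \<otimes> inv (y [^] j) =
            inv g \<otimes> (path v \<otimes> y [^] j) \<otimes> inv (y [^] j)" by simp
        then have "path (\<phi> (inv g) v) \<otimes> y [^] (- j) = inv g \<otimes> path v"
          using g by (simp add: m_assoc inv_cancel int_pow_neg)
        then show ?thesis by metis
      qed
      then show ?thesis using g by (simp add: K_def)
    qed
    show "g \<otimes> h \<in> K" if "g \<in> K" "h \<in> K" for g h
    proof -
      have c: "g \<in> carrier G" "h \<in> carrier G" using that by (auto simp: K_def)
      have "\<exists>j :: int. g \<otimes> h \<otimes> path v = path (\<phi> (g \<otimes> h) v) \<otimes> y [^] j" if v: "v \<in> vertices" for v
      proof -
        obtain j :: int where j: "h \<otimes> path v = path (\<phi> h v) \<otimes> y [^] j"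
          using \<open>h \<in> K\<close> v by (auto simp: K_def)
        obtain i :: int where i: "g \<otimes> path (\<phi> h v) = path (\<phi> g (\<phi> h v)) \<otimes> y [^] i"
          using \<open>g \<in> K\<close> act_closed[OF c(2) v] unfolding K_def by blast
        have "g \<otimes> h \<otimes> path v = (g \<otimes> path (\<phi> h v)) \<otimes> y [^] j"
          using c j by (simp add: m_assoc)
        also have "\<dots> = path (\<phi> (g \<otimes> h) v) \<otimes> y [^] (i + j)"
          using c v by (simp add: i m_assoc act_mult int_pow_mult)
        finally show ?thesis by blast
      qed
      then show ?thesis using c by (simp add: K_def)
    qed
  qed (auto simp: K_def)
  then have "carrier G \<subseteq> K"
    by (rule generated) (auto simp: K_def act_x act_y x_path y_path)
  then show ?thesis using assms by (auto simp: K_def)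
qed

lemma path_decomposition:
  "g \<in> carrier G \<Longrightarrow> \<exists>j :: int. g = path (\<phi> g []) \<otimes> y [^] j"
  using act_path_stabilizer[of g "[]"] by simp

text \<open>Two elements that carry the root to the same vertex differ by a power of \<open>y\<close>, which the
  exponent sum detects.\<close>

lemma act_expo_inj:
  assumes "g \<in> carrier G" "h \<in> carrier G" "\<phi> g [] = \<phi> h []" "expo g = expo h"
  shows "g = h"
proof -
  define p where "p = path (\<phi> g [])"
  have p: "p \<in> carrier G" by (simp add: p_def)
  obtain i j :: int where ij: "g = p \<otimes> y [^] i" "h = p \<otimes> y [^] j"
    using path_decomposition[OF assms(1)] path_decomposition[OF assms(2)]
    unfolding p_def assms(3) by blast
  have "expo g = expo p + 2 * i" "expo h = expo p + 2 * j"
    using p by (simp_all add: ij expo_mult expo_pow_y)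
  then have "i = j" using assms by simp
  then show ?thesis using ij by simp
qed

abbreviation len :: "'a \<Rightarrow> nat" where
  "len g \<equiv> length (\<phi> g [])"

abbreviation common :: "'a \<Rightarrow> 'a \<Rightarrow> nat" where
  "common g h \<equiv> lcp (\<phi> g []) (\<phi> h [])"

lemma len_quotient:
  assumes "g \<in> carrier G" "h \<in> carrier G"
  shows "len (inv g \<otimes> h) + 2 * common g h = len g + len h"
proof -
  have "len (inv g \<otimes> h) = tree_dist [] (\<phi> (inv g \<otimes> h) [])" by (simp add: tree_dist_def)
  also have "\<dots> = tree_dist (\<phi> g []) (\<phi> g (\<phi> (inv g \<otimes> h) []))"
    using assms by (simp add: act_isometry)
  also have "\<phi> g (\<phi> (inv g \<otimes> h) []) = \<phi> h []"
    using assms by (simp add: act_mult act_inv)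
  finally show ?thesis by (simp add: tree_dist_add)
qed

sublocale L: tree_length G len common
  by unfold_locales (auto simp: len_quotient lcp_ultrametric lcp_le act_one intro: lcp_commute)

text \<open>In the braid group \<open>y\<inverse>x = \<sigma>\<^sub>1\<close>.\<close>

definition half_twists :: "'a set" where
  "half_twists = {g \<otimes> (inv y \<otimes> x) \<otimes> inv g | g. g \<in> carrier G}"

abbreviation conjugate :: "'a \<Rightarrow> 'a \<Rightarrow> 'a" where
  "conjugate g Y \<equiv> g \<otimes> Y \<otimes> inv g"

lemma conj_mult:
  "g \<in> carrier G \<Longrightarrow> h \<in> carrier G \<Longrightarrow> Y \<in> carrier G \<Longrightarrow> conjugate (g \<otimes> h) Y = conjugate g (conjugate h Y)"
  by (simp add: m_assoc inv_mult_group)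

text \<open>The half twists along the three horocycles through the root. The rotation \<open>y\<close> permutes them
  cyclically; the first two, which are \<open>\<sigma>\<^sub>1\<close> and \<open>\<sigma>\<^sub>2\<close>, belong to the horocycles through the edge that
  \<open>x\<close> reverses, and \<open>x\<close> exchanges them.\<close>

definition short_twists :: "'a set" where
  "short_twists = {inv y \<otimes> x, x \<otimes> inv y, y \<otimes> x \<otimes> inv y \<otimes> inv y}"

lemma short_twists_carrier: "short_twists \<subseteq> carrier G"
  by (auto simp: short_twists_def)

lemma conj_y_last: "conjugate y (y \<otimes> x \<otimes> inv y \<otimes> inv y) = inv y \<otimes> x"
proof -
  have "y \<otimes> (conjugate y (y \<otimes> x \<otimes> inv y \<otimes> inv y)) = (x \<otimes> x) \<otimes> x \<otimes> inv (y \<otimes> (y \<otimes> y))"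
    by (simp add: square_cube m_assoc inv_mult_group)
  also have "\<dots> = x \<otimes> ((x \<otimes> x) \<otimes> inv (x \<otimes> x))"
    unfolding square_cube[symmetric] by (simp add: m_assoc)
  finally have "inv y \<otimes> (y \<otimes> (conjugate y (y \<otimes> x \<otimes> inv y \<otimes> inv y))) = inv y \<otimes> x" by simp
  then show ?thesis by (subst (asm) inv_cancel) auto
qed

lemma conj_y: "Y \<in> short_twists \<Longrightarrow> conjugate y Y \<in> short_twists"
  using conj_y_last by (auto simp: short_twists_def m_assoc inv_cancel)

lemma conj_inv_y: "Y \<in> short_twists \<Longrightarrow> conjugate (inv y) Y \<in> short_twists"
proof -
  have "conjugate (inv y) (inv y \<otimes> x) = y \<otimes> x \<otimes> inv y \<otimes> inv y"
    by (subst conj_y_last[symmetric]) (simp add: m_assoc inv_cancel)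
  then show "Y \<in> short_twists \<Longrightarrow> conjugate (inv y) Y \<in> short_twists"
    by (auto simp: short_twists_def m_assoc inv_cancel)
qed

lemma conj_pow:
  assumes "g \<in> carrier G" "\<And>Y. Y \<in> short_twists \<Longrightarrow> conjugate g Y \<in> short_twists" "Y \<in> short_twists"
  shows "conjugate (g [^] (n :: nat)) Y \<in> short_twists"
  using assms(3)
proof (induction n arbitrary: Y)
  case 0
  then show ?case using short_twists_carrier by auto
next
  case (Suc n)
  have "Y \<in> carrier G" using Suc.prems short_twists_carrier by auto
  then have "conjugate (g [^] Suc n) Y = conjugate (g [^] n) (conjugate g Y)"
    using assms(1) conj_mult[of "g [^] n" g Y] by simp
  then show ?case using Suc assms(2) by simp
qed

lemma conj_int_pow_y: "Y \<in> short_twists \<Longrightarrow> conjugate (y [^] (j :: int)) Y \<in> short_twists"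
proof (cases j rule: int_cases2)
  case (nonneg n)
  then show "Y \<in> short_twists \<Longrightarrow> ?thesis"
    using conj_pow[of y Y n] conj_y by (simp add: int_pow_int)
next
  case (nonpos n)
  then have "y [^] j = inv y [^] n" by (simp add: int_pow_neg_int nat_pow_inv)
  then show "Y \<in> short_twists \<Longrightarrow> ?thesis"
    using conj_pow[of "inv y" Y n] conj_inv_y by simp
qed

lemma conj_x:
  "conjugate x (inv y \<otimes> x) = x \<otimes> inv y" "conjugate x (x \<otimes> inv y) = inv y \<otimes> x"
proof -
  show "conjugate x (inv y \<otimes> x) = x \<otimes> inv y" by (simp add: m_assoc)
  have "y \<otimes> conjugate x (x \<otimes> inv y) = (y \<otimes> (x \<otimes> x)) \<otimes> (inv y \<otimes> inv x)" by (simp add: m_assoc)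
  also have "\<dots> = x" unfolding square_commute_y[symmetric] by (simp add: m_assoc inv_cancel)
  finally have "inv y \<otimes> (y \<otimes> conjugate x (x \<otimes> inv y)) = inv y \<otimes> x" by simp
  then show "conjugate x (x \<otimes> inv y) = inv y \<otimes> x" by (subst (asm) inv_cancel) auto
qed

text \<open>Conjugation by the last step of \<open>v\<close> turns each of the first two short half twists into a short one
  again, so this step can be dropped. For the third one, \<open>v\<close> is already a shortest way from the root to
  the horocycle.\<close>

lemma conj_path:
  "Y \<in> short_twists \<Longrightarrow> v \<in> vertices \<Longrightarrow> conjugate (path v) Y \<in> short_twists \<or>
    (\<exists>w\<in>vertices. w \<noteq> [] \<and> conjugate (path v) Y = conjugate (path w) (y \<otimes> x \<otimes> inv y \<otimes> inv y))"
proof (induction v arbitrary: Y rule: rev_induct)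
  case Nil
  then show ?case using short_twists_carrier by auto
next
  case (snoc e v)
  have v: "v \<in> vertices" using snoc.prems by (cases v) (auto simp: vertices_def)
  show ?case
  proof (cases "Y = y \<otimes> x \<otimes> inv y \<otimes> inv y")
    case True
    then show ?thesis using snoc.prems by blast
  next
    case False
    then have "conjugate x Y \<in> short_twists"
      using snoc.prems conj_x by (auto simp: short_twists_def)
    then have s: "conjugate (y [^] e) (conjugate x Y) \<in> short_twists"
      using conj_pow[of y] conj_y by simp
    have "Y \<in> carrier G" using snoc.prems short_twists_carrier by auto
    then have "conjugate (path (v @ [e])) Y = conjugate (path v) (conjugate (y [^] e) (conjugate x Y))"
      unfolding path_append by (simp add: conj_mult)
    then show ?thesis using snoc.IH[OF s v] by simp
  qed
qed

lemma half_twist_cases: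
  assumes "Y \<in> half_twists"
  shows "Y \<in> short_twists \<or>
    (\<exists>w\<in>vertices. w \<noteq> [] \<and> Y = conjugate (path w) (y \<otimes> x \<otimes> inv y \<otimes> inv y))"
proof -
  obtain g where g: "g \<in> carrier G" "Y = conjugate g (inv y \<otimes> x)"
    using assms by (auto simp: half_twists_def)
  define p where "p = path (\<phi> g [])"
  obtain j :: int where j: "g = p \<otimes> y [^] j"
    using path_decomposition[OF g(1)] unfolding p_def by blast
  have "conjugate (y [^] j) (inv y \<otimes> x) \<in> short_twists"
    by (rule conj_int_pow_y) (simp add: short_twists_def)
  moreover have "Y = conjugate p (conjugate (y [^] j) (inv y \<otimes> x))"
    using conj_mult[of p "y [^] j" "inv y \<otimes> x"] unfolding g(2) j[symmetric] by (simp add: p_def)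
  ultimately show ?thesis using conj_path g(1) by (simp add: p_def)
qed

text \<open>Read backwards, the path from the root to \<open>w\<close> starts with the edge that \<open>x\<close> reverses.\<close>

lemma act_inv_path:
  assumes "w \<in> vertices" "w \<noteq> []"
  shows "\<exists>q. \<phi> (inv (path w)) [] = 0 # q \<and> Suc (length q) = length w"
proof -
  obtain u e where w: "w = u @ [e]" using assms(2) by (metis rev_exhaust)
  have u: "u \<in> vertices" using assms w by (cases u) (auto simp: vertices_def)
  define h where "h = path u \<otimes> y [^] e"
  have h: "h \<in> carrier G" by (simp add: h_def)
  have "path w = h \<otimes> x" by (simp add: w h_def path_append m_assoc)
  then have "\<phi> (inv (path w)) [] = flip (\<phi> (inv h) [])"
    using h by (simp add: inv_mult_group act_mult act_inv_x)
  moreover have "len (inv (path w)) = length w"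
    using act_path[of w "[]"] assms(1) by (simp add: L.len_inv)
  moreover have "(rot ^^ e) [] = []" by (induction e) auto
  then have "len (inv h) = length u"
    using act_path[of u "[]"] u act_pow_y[of "[]" e] h
    by (simp add: L.len_inv) (simp add: h_def act_mult)
  ultimately have "\<phi> (inv (path w)) [] = 0 # \<phi> (inv h) [] \<and> Suc (len (inv h)) = length w"
    by (auto simp: flip_def w split: if_splits)
  then show ?thesis by blast
qed

text \<open>The geodesic to \<open>Y o\<close> follows \<open>w\<close> to the horocycle and takes the branch 1 as its middle step, whereas
  the geodesic to \<open>Y\<inverse> o\<close> takes the branch 2. This is the common turning direction of all half
  twists.\<close>

lemma long_twist_shape:
  assumes w: "w \<in> vertices" "w \<noteq> []" and Y: "Y = conjugate (path w) (y \<otimes> x \<otimes> inv y \<otimes> inv y)"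
  shows "\<exists>q. \<phi> Y [] = w @ 1 # 1 # q \<and> \<phi> (inv Y) [] = w @ 2 # 2 # q \<and> Suc (length q) = length w"
proof -
  obtain q where q: "\<phi> (inv (path w)) [] = 0 # q" "Suc (length q) = length w"
    using act_inv_path[OF w] by blast
  have z: "0 # q \<in> vertices" using q(1) act_closed[of "inv (path w)" "[]"] by simp
  then have q0: "q \<in> vertices" "0 \<notin> set q" by (auto simp: vertices_Cons)
  have f: "flip (Suc 0 # q) = 0 # Suc 0 # q" "flip (2 # q) = 0 # 2 # q" by (auto simp: flip_def)
  have v: "w @ Suc 0 # Suc 0 # q \<in> vertices" "w @ 2 # 2 # q \<in> vertices"
    using w q0 by (cases w; auto simp: vertices_def dest: list.set_sel(2))+
  have i: "inv Y = path w \<otimes> (y \<otimes> (y \<otimes> (inv x \<otimes> (inv y \<otimes> inv (path w)))))"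
    unfolding Y by (simp add: inv_mult_group m_assoc)
  have "\<phi> Y [] = w @ 1 # 1 # q"
    using z q0 v act_path[OF v(1)] f
    by (simp add: Y act_mult q(1) act_inv_y act_x act_y vertices_Cons numeral_2_eq_2)
  moreover have "\<phi> (inv Y) [] = w @ 2 # 2 # q"
    using z q0 v act_path[OF v(2)] f
    by (simp add: i act_mult q(1) act_inv_y act_inv_x act_y vertices_Cons numeral_2_eq_2)
  ultimately show ?thesis using q(2) by blast
qed

lemma short_twist_shape:
  assumes "Y \<in> short_twists"
  shows "\<exists>a b. a \<noteq> b \<and> \<phi> Y [] = [a] \<and> \<phi> (inv Y) [] = [b]"
  using assms unfolding short_twists_def
  by (auto simp: inv_mult_group m_assoc act_mult act_inv_y act_inv_x act_x act_y flip_def vertices_Cons)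

lemma half_twists_carrier: "half_twists \<subseteq> carrier G"
  by (auto simp: half_twists_def)

lemma half_twist_middle:
  assumes "Y \<in> half_twists"
  shows "2 * common Y (inv Y) + 1 = len Y"
  using half_twist_cases[OF assms]
proof (elim disjE bexE conjE)
  assume "Y \<in> short_twists"
  then obtain a b where "a \<noteq> b" "\<phi> Y [] = [a]" "\<phi> (inv Y) [] = [b]"
    using short_twist_shape by blast
  then show ?thesis by simp
next
  fix w assume "w \<in> vertices" "w \<noteq> []" "Y = conjugate (path w) (y \<otimes> x \<otimes> inv y \<otimes> inv y)"
  from long_twist_shape[OF this] show ?thesis
    using lcp_append_differ[of "1 :: nat" 2 w] by force
qed

text \<open>For half twists of length 1 the middle step may be any of the three branches at the root.\<close>

lemma half_twist_shape:
  assumes "Y \<in> half_twists" "1 < len Y"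
  shows "\<exists>w q. \<phi> Y [] = w @ 1 # 1 # q \<and> \<phi> (inv Y) [] = w @ 2 # 2 # q \<and> len Y = 2 * length w + 1"
  using half_twist_cases[OF assms(1)]
proof (elim disjE bexE conjE)
  assume "Y \<in> short_twists"
  then have "len Y = 1" using short_twist_shape by fastforce
  then show ?thesis using assms(2) by simp
next
  fix w assume "w \<in> vertices" "w \<noteq> []" "Y = conjugate (path w) (y \<otimes> x \<otimes> inv y \<otimes> inv y)"
  from long_twist_shape[OF this] show ?thesis by force
qed

lemma expo_half_twist: "Y \<in> half_twists \<Longrightarrow> expo Y = 1"
  by (auto simp: half_twists_def expo_mult expo_inv expo_x expo_y)

sublocale H: hurwitz_reduction G len common half_twists
proof
  show "half_twists \<subseteq> carrier G" by (rule half_twists_carrier)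
  show "conjugate g Y \<in> half_twists" if "g \<in> carrier G" "Y \<in> half_twists" for g Y
    using that conj_mult[of g _ "inv y \<otimes> x"] unfolding half_twists_def
    by simp (metis m_closed)
  show "2 * common Y (inv Y) + 1 = len Y" if "Y \<in> half_twists" for Y
    using half_twist_middle[OF that] .
  show "2 * common (inv Y) Z < len Z"
    if Y: "Y \<in> half_twists" and Z: "Z \<in> half_twists" and l: "len Y = len Z" "1 < len Z" for Y Z
  proof -
    obtain w q where w: "\<phi> (inv Y) [] = w @ 2 # 2 # q" "len Y = 2 * length w + 1"
      using half_twist_shape[OF Y] l by auto
    obtain w' q' where w': "\<phi> Z [] = w' @ 1 # 1 # q'" "len Z = 2 * length w' + 1"
      using half_twist_shape[OF Z] l by auto
    have "common (inv Y) Z \<le> length w"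
      unfolding w w' using w w' l(1) by (intro lcp_differ) auto
    then show ?thesis using w l by simp
  qed
  show "finite {Y \<in> half_twists. len Y \<le> n}" for n
  proof (rule inj_on_finite[OF _ _ finite_short_vertices[of n]])
    show "inj_on (\<lambda>Y. \<phi> Y []) {Y \<in> half_twists. len Y \<le> n}"
      using half_twists_carrier expo_half_twist by (intro inj_onI act_expo_inj) auto
    show "(\<lambda>Y. \<phi> Y []) ` {Y \<in> half_twists. len Y \<le> n} \<subseteq> {v \<in> vertices. length v \<le> n}"
      using half_twists_carrier by auto
  qed
qed

lemma expo_product: "set Xs \<subseteq> half_twists \<Longrightarrow> expo (list_product Xs) = int (length Xs)"
proof (induction Xs)
  case (Cons Y Xs)
  have "expo Y = 1"
    using Cons.prems by (simp add: expo_half_twist)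
  moreover have "Y \<in> carrier G" "list_product Xs \<in> carrier G"
    using Cons.prems half_twists_carrier list_product_closed[of Xs] by auto
  moreover have "expo (list_product Xs) = int (length Xs)" using Cons by simp
  ultimately show ?case by (simp add: expo_mult)
qed (simp add: expo_one)

text \<open>The exponent sum of the product determines the number of factors.\<close>

theorem finite_factorization_representatives:
  assumes "X \<in> carrier G"
  shows "\<exists>R. finite R \<and> (\<forall>Xs. set Xs \<subseteq> half_twists \<and> list_product Xs = X \<longrightarrow>
    (\<exists>Ys\<in>R. hurwitz_equiv G Xs Ys))"
proof -
  obtain R where "finite R" "\<forall>Xs. set Xs \<subseteq> half_twists \<and> length Xs = nat (expo X) \<and>
      list_product Xs = X \<longrightarrow> (\<exists>Ys\<in>R. hurwitz_equiv G Xs Ys)"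
    using H.finite_representatives[OF assms] by blast
  moreover have "length Xs = nat (expo X)" if "set Xs \<subseteq> half_twists" "list_product Xs = X" for Xs
    using expo_product[OF that(1)] that(2) by simp
  ultimately show ?thesis by blast
qed

end

section \<open>The braid group on three strings\<close>

text \<open>Keeps the index 1 of the first generator in the form in which it occurs in
  \<open>braid_gen 3 1\<close>.\<close>

lemmas [simp del] = One_nat_def

interpretation B: group "braid_group 3"
  by (rule group_braid_group)

abbreviation B_mult (infixl "\<cdot>" 70) where
  "g \<cdot> h \<equiv> g \<otimes>\<^bsub>braid_group 3\<^esub> h"

abbreviation \<sigma>\<^sub>1 where "\<sigma>\<^sub>1 \<equiv> braid_gen 3 1"
abbreviation \<sigma>\<^sub>2 where "\<sigma>\<^sub>2 \<equiv> braid_gen 3 2"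

lemma sigma_carrier [simp]: "\<sigma>\<^sub>1 \<in> carrier (braid_group 3)" "\<sigma>\<^sub>2 \<in> carrier (braid_group 3)"
  by (auto intro: braid_gen_carrier)

lemma braid_relation: "\<sigma>\<^sub>1 \<cdot> \<sigma>\<^sub>2 \<cdot> \<sigma>\<^sub>1 = \<sigma>\<^sub>2 \<cdot> \<sigma>\<^sub>1 \<cdot> \<sigma>\<^sub>2"
proof -
  have "([(1, True), (2, True), (1, True)], [(2, True), (1, True), (2, True)]) \<in>
      word_rel {1..<3} (braid_relations 3)"
    by (rule word_rel.relation) (auto simp: braid_relations_3)
  then show ?thesis
    by (simp add: braid_group_def braid_gen_def presented_mult equiv_class_eq[OF equiv_word_rel])
qed

text \<open>Recursion over the letters of a word, for the proof that the generators generate.\<close>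

lemma braid_class_Cons:
  assumes "i \<in> {1..<n}" "u \<in> words {1..<n}"
  shows "word_rel {1..<n} (braid_relations n) `` {(i, b) # u} =
    (if b then braid_gen n i else inv\<^bsub>braid_group n\<^esub> braid_gen n i) \<otimes>\<^bsub>braid_group n\<^esub>
      word_rel {1..<n} (braid_relations n) `` {u}"
proof -
  interpret G: group "braid_group n" by (rule group_braid_group)
  let ?c = "\<lambda>u. word_rel {1..<n} (braid_relations n) `` {u}"
  have mult: "?c [(i, c)] \<otimes>\<^bsub>braid_group n\<^esub> ?c v = ?c ((i, c) # v)" if "v \<in> words {1..<n}" for c v
    using that assms(1) by (simp add: braid_group_def presented_mult)
  have car: "?c [(i, c)] \<in> carrier (braid_group n)" for c
    using assms(1) by (auto simp: braid_group_def intro: presented_carrierI)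
  have "?c [(i, False), (i, True)] = ?c []"
    using word_rel.cancel[of i "{1..<n}" False "braid_relations n"] assms(1)
    by (simp add: equiv_class_eq[OF equiv_word_rel])
  then have "?c [(i, False)] \<otimes>\<^bsub>braid_group n\<^esub> ?c [(i, True)] = \<one>\<^bsub>braid_group n\<^esub>"
    using assms(1) by (simp add: mult) (simp add: braid_group_def presented_one)
  then have "?c [(i, False)] = inv\<^bsub>braid_group n\<^esub> braid_gen n i"
    using car G.inv_equality[of "?c [(i, False)]" "?c [(i, True)]"] by (simp add: braid_gen_def)
  then show ?thesis using mult[OF assms(2), of b] by (auto simp: braid_gen_def)
qed

lemma braid_group_generated:
  assumes "subgroup K (braid_group n)" "\<And>i. i \<in> {1..<n} \<Longrightarrow> braid_gen n i \<in> K"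
  shows "carrier (braid_group n) \<subseteq> K"
proof
  interpret G: group "braid_group n" by (rule group_braid_group)
  interpret K: subgroup K "braid_group n" by (fact assms(1))
  have K: "word_rel {1..<n} (braid_relations n) `` {u} \<in> K" if "u \<in> words {1..<n}" for u
    using that
  proof (induction u)
    case Nil
    then show ?case using K.one_closed by (simp add: braid_group_def presented_one)
  next
    case (Cons a u)
    then show ?case
      using braid_class_Cons[of "fst a" n u "snd a"] assms(2)[of "fst a"] by auto
  qed
  fix A assume "A \<in> carrier (braid_group n)"
  then show "A \<in> K" unfolding braid_group_def by (rule presented_carrierE) (auto intro: K)
qed

definition braid_exponent :: "nat word set \<Rightarrow> int" where
  "braid_exponent = hom_of_generators integer_group (\<lambda>_. 1)"

lemma exponent_relation:
  "(u, v) \<in> braid_relations n \<Longrightarrow>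
    word_value integer_group (\<lambda>_. 1) u = word_value integer_group (\<lambda>_. 1) v"
  by (auto simp: braid_relations_def word_value_def)

lemma braid_exponent_hom: "braid_exponent \<in> hom (braid_group 3) integer_group"
  unfolding braid_exponent_def braid_group_def
  by (rule hom_of_generators_hom) (auto intro: exponent_relation)

lemma braid_exponent_gen:
  assumes "i \<in> {1..<3}"
  shows "braid_exponent (braid_gen 3 i) = 1"
proof -
  have "braid_exponent (braid_gen 3 i) = word_value integer_group (\<lambda>_. 1) [(i, True)]"
    unfolding braid_exponent_def braid_gen_def using assms
    by (intro hom_of_generators_class) (auto intro: exponent_relation)
  then show ?thesis by (simp add: word_value_def)
qed

text \<open>These formulas are forced by \<open>\<sigma>\<^sub>1 = y\<inverse>x\<close> and \<open>\<sigma>\<^sub>2 = x\<inverse>y\<^sup>2\<close>, as \<open>rot\<close> has order 3 and \<open>flip\<close> has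
  order 2.\<close>

definition gen_on_tree :: "nat \<Rightarrow> nat list \<Rightarrow> nat list" where
  "gen_on_tree i = (\<lambda>v\<in>vertices. if i = 1 then rot (rot (flip v)) else flip (rot (rot v)))"

lemma gen_on_tree_Bij: "gen_on_tree i \<in> carrier (BijGroup vertices)"
proof -
  have "bij_betw (gen_on_tree i) vertices vertices"
    by (rule bij_betw_byWitness[where f' = "\<lambda>v. if i = 1 then flip (rot v) else rot (flip v)"])
      (auto simp: gen_on_tree_def rot_vertex flip_vertex rot_3 flip_flip)
  then show ?thesis by (simp add: BijGroup_def Bij_def gen_on_tree_def)
qed

lemma gen_on_tree_relation:
  assumes "(u, v) \<in> braid_relations 3"
  shows "word_value (BijGroup vertices) gen_on_tree u = word_value (BijGroup vertices) gen_on_tree v"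
proof -
  let ?H = "BijGroup vertices"
  interpret H: group ?H by (rule group_BijGroup)
  have mult: "g \<otimes>\<^bsub>?H\<^esub> h = compose vertices g h"
    if "g \<in> carrier ?H" "h \<in> carrier ?H" for g h
    using that by (simp add: BijGroup_def)
  have "compose vertices (gen_on_tree 1) (compose vertices (gen_on_tree 2) (gen_on_tree 1)) =
      compose vertices (gen_on_tree 2) (compose vertices (gen_on_tree 1) (gen_on_tree 2))"
    by (intro ext)
      (simp add: compose_def restrict_def gen_on_tree_def rot_vertex flip_vertex rot_3 flip_flip)
  then show ?thesis
    using assms gen_on_tree_Bij by (auto simp: braid_relations_3 word_value_def simp flip: mult)
qed

definition tree_action :: "nat word set \<Rightarrow> nat list \<Rightarrow> nat list" where
  "tree_action = hom_of_generators (BijGroup vertices) gen_on_tree"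

lemma tree_action: "group_action (braid_group 3) vertices tree_action"
proof -
  have "tree_action \<in> hom (braid_group 3) (BijGroup vertices)"
    unfolding tree_action_def braid_group_def
    by (intro hom_of_generators_hom group_BijGroup gen_on_tree_Bij gen_on_tree_relation)
  then show ?thesis
    by (simp add: group_action_def group_hom_def group_hom_axioms_def group_braid_group
        group_BijGroup)
qed

lemma tree_action_gen:
  assumes "i \<in> {1..<3}"
  shows "tree_action (braid_gen 3 i) = gen_on_tree i"
proof -
  interpret H: group "BijGroup vertices" by (rule group_BijGroup)
  have "tree_action (braid_gen 3 i) = word_value (BijGroup vertices) gen_on_tree [(i, True)]"
    unfolding tree_action_def braid_gen_def using assms
    by (intro hom_of_generators_class group_BijGroup gen_on_tree_Bij gen_on_tree_relation) auto
  then show ?thesis using gen_on_tree_Bij by (simp add: word_value_def)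
qed

interpretation T: trefoil_action "braid_group 3" "\<sigma>\<^sub>1 \<cdot> \<sigma>\<^sub>2 \<cdot> \<sigma>\<^sub>1" "\<sigma>\<^sub>1 \<cdot> \<sigma>\<^sub>2" braid_exponent tree_action
proof (intro trefoil_action.intro trefoil_action_axioms.intro)
  interpret A: group_action "braid_group 3" vertices tree_action by (rule tree_action)
  show "\<sigma>\<^sub>1 \<cdot> \<sigma>\<^sub>2 \<cdot> \<sigma>\<^sub>1 \<cdot> (\<sigma>\<^sub>1 \<cdot> \<sigma>\<^sub>2 \<cdot> \<sigma>\<^sub>1) = \<sigma>\<^sub>1 \<cdot> \<sigma>\<^sub>2 \<cdot> (\<sigma>\<^sub>1 \<cdot> \<sigma>\<^sub>2 \<cdot> (\<sigma>\<^sub>1 \<cdot> \<sigma>\<^sub>2))"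
  proof -
    have "\<sigma>\<^sub>1 \<cdot> \<sigma>\<^sub>2 \<cdot> \<sigma>\<^sub>1 \<cdot> (\<sigma>\<^sub>1 \<cdot> \<sigma>\<^sub>2 \<cdot> \<sigma>\<^sub>1) = \<sigma>\<^sub>1 \<cdot> \<sigma>\<^sub>2 \<cdot> \<sigma>\<^sub>1 \<cdot> (\<sigma>\<^sub>2 \<cdot> \<sigma>\<^sub>1 \<cdot> \<sigma>\<^sub>2)"
      by (simp only: braid_relation)
    also have "\<dots> = \<sigma>\<^sub>1 \<cdot> \<sigma>\<^sub>2 \<cdot> (\<sigma>\<^sub>1 \<cdot> \<sigma>\<^sub>2 \<cdot> (\<sigma>\<^sub>1 \<cdot> \<sigma>\<^sub>2))"
      by (simp add: B.m_assoc)
    finally show ?thesis .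
  qed
  have e: "braid_exponent (g \<cdot> h) = braid_exponent g + braid_exponent h"
    if "g \<in> carrier (braid_group 3)" "h \<in> carrier (braid_group 3)" for g h
    using hom_mult[OF braid_exponent_hom that] by simp
  show "braid_exponent (\<sigma>\<^sub>1 \<cdot> \<sigma>\<^sub>2 \<cdot> \<sigma>\<^sub>1) = 3" "braid_exponent (\<sigma>\<^sub>1 \<cdot> \<sigma>\<^sub>2) = 2"
    by (simp_all add: e braid_exponent_gen)
  show "carrier (braid_group 3) \<subseteq> K"
    if K: "subgroup K (braid_group 3)" "\<sigma>\<^sub>1 \<cdot> \<sigma>\<^sub>2 \<cdot> \<sigma>\<^sub>1 \<in> K" "\<sigma>\<^sub>1 \<cdot> \<sigma>\<^sub>2 \<in> K" for K
  proof (rule braid_group_generated[OF K(1)])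
    interpret K: subgroup K "braid_group 3" by (rule K)
    have "inv\<^bsub>braid_group 3\<^esub> (\<sigma>\<^sub>1 \<cdot> \<sigma>\<^sub>2) \<cdot> (\<sigma>\<^sub>1 \<cdot> \<sigma>\<^sub>2 \<cdot> \<sigma>\<^sub>1) \<in> K" using K by simp
    then have 1: "\<sigma>\<^sub>1 \<in> K" by (simp add: B.m_assoc B.inv_mult_group B.inv_cancel)
    then have "inv\<^bsub>braid_group 3\<^esub> \<sigma>\<^sub>1 \<cdot> (\<sigma>\<^sub>1 \<cdot> \<sigma>\<^sub>2) \<in> K" using K by simp
    then have 2: "\<sigma>\<^sub>2 \<in> K" by (simp add: B.inv_cancel)
    show "braid_gen 3 i \<in> K" if "i \<in> {1..<3}" for i
    proof -
      have "i = 1 \<or> i = 2" using that by auto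
      then show ?thesis using 1 2 by auto
    qed
  qed
  show "tree_action (\<sigma>\<^sub>1 \<cdot> \<sigma>\<^sub>2) v = rot v" if "v \<in> vertices" for v
    using that
    by (simp add: A.composition_rule tree_action_gen gen_on_tree_def rot_vertex flip_vertex
        flip_flip rot_3)
  then show "tree_action (\<sigma>\<^sub>1 \<cdot> \<sigma>\<^sub>2 \<cdot> \<sigma>\<^sub>1) v = flip v" if "v \<in> vertices" for v
    using that
    by (simp add: A.composition_rule[of _ "\<sigma>\<^sub>1 \<cdot> \<sigma>\<^sub>2" \<sigma>\<^sub>1] tree_action_gen gen_on_tree_def rot_vertex
        flip_vertex rot_3)
qed (auto intro: group_braid_group braid_exponent_hom tree_action)

lemma half_twists_iff:
  "Y \<in> T.half_twists \<longleftrightarrow>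
    (\<exists>g\<in>carrier (braid_group 3). Y = g \<cdot> \<sigma>\<^sub>1 \<cdot> inv\<^bsub>braid_group 3\<^esub> g)"
proof -
  have "inv\<^bsub>braid_group 3\<^esub> (\<sigma>\<^sub>1 \<cdot> \<sigma>\<^sub>2) \<cdot> (\<sigma>\<^sub>1 \<cdot> \<sigma>\<^sub>2 \<cdot> \<sigma>\<^sub>1) = \<sigma>\<^sub>1"
    by (simp add: B.m_assoc B.inv_mult_group B.inv_cancel)
  then show ?thesis by (auto simp: T.half_twists_def)
qed

theorem corollary2:
  fixes X :: "nat word set"
  assumes "X \<in> carrier (braid_group 3)"
  shows "finite (\<Union>k. orbits (braid_group k)
           {Xs \<in> quasipositive_factorizations X. length Xs = k}
           (hurwitz_action (braid_group 3) k))"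
proof -
  let ?orb = "\<lambda>Xs. orbit (braid_group (length Xs)) (hurwitz_action (braid_group 3) (length Xs)) Xs"
  have Q: "quasipositive_factorizations X = {Xs. set Xs \<subseteq> T.half_twists \<and> B.list_product Xs = X}"
    by (auto simp: quasipositive_factorizations_def half_twists_iff)
  obtain R where R: "finite R"
    "\<And>Xs. Xs \<in> quasipositive_factorizations X \<Longrightarrow> \<exists>Ys\<in>R. hurwitz_equiv (braid_group 3) Xs Ys"
    using T.finite_factorization_representatives[OF assms] unfolding Q by blast
  have "?orb Xs \<in> ?orb ` R" if Xs: "Xs \<in> quasipositive_factorizations X" for Xs
  proof -
    obtain Ys where Ys: "Ys \<in> R" "hurwitz_equiv (braid_group 3) Xs Ys" using R(2)[OF Xs] by blast
    have "set Xs \<subseteq> carrier (braid_group 3)" using Xs T.half_twists_carrier by (auto simp: Q)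
    then show ?thesis using B.hurwitz_equiv_orbit[OF Ys(2)] Ys(1) by auto
  qed
  then have "(\<Union>k. orbits (braid_group k) {Xs \<in> quasipositive_factorizations X. length Xs = k}
      (hurwitz_action (braid_group 3) k)) \<subseteq> ?orb ` R"
    unfolding orbits_def by blast
  then show ?thesis using R(1) finite_subset by blast
qed

end
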